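(* For every $(g,x,y)\in\mathcal Z$, $$\delta_3(x,y)\ \ge\ \frac{\sqrt5-1}{4}\ >\ \frac14 .$$
   Context: Let $\mathbb H$ be the quaternions, $\operatorname{Im}\mathbb H\cong\mathbb R^3$ the imaginary quaternions with Euclidean product $u\cdot v=-\operatorname{Re}(uv)$. $G=\operatorname{Sp}(2)=\{Q\in M_2(\mathbb H):QQ^*=Q^*Q=I\}$ ($^*$ on matrices is conjugate transpose), $\mathfrak g=\mathfrak{sp}(2)=\{A\in M_2(\mathbb H):A^*+A=0\}$, with inner product $B(U,V)=-\frac12\operatorname{Re}\operatorname{tr}_{\mathbb H}(UV)$ and $|U|^2=B(U,U)$. Elements of $\mathfrak g$ are written uniquely as $$(r;u_0,u_1,u_2)=\begin{pmatrix}u_0+u_1&r+u_2\\-r+u_2&u_0-u_1\end{pmatrix},\quad r\in\mathbb R,\ u_i\in\operatorname{Im}\mathbb H.$$ Put $S(r;u_0,u_1,u_2)=(3r;u_1,u_0-u_2,-u_1)$. For $g\in G$ and $\xi\in\operatorname{Im}\mathbb H$ put $D\xi=\operatorname{diag}(\xi,\xi)$, $E_g\xi=g\operatorname{diag}(\xi,0)g^*$, $J_g=D-E_g$, as linear maps $\operatorname{Im}\mathbb H\to\mathfrak g$; $D^*,J_g^*:\mathfrak g\to\operatorname{Im}\mathbb H$ denote adjoints with respect to $B$ and the Euclidean product (so $D^*(r;u_0,u_1,u_2)=u_0$). For $x,y\in\mathfrak g$ (with $[\cdot,\cdot]$ the matrix commutator): $$c=[x,y],\quad a=[Sx,y]+[x,Sy],\quad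 b=[Sx,Sy],\quad h=[Sx,y]-[x,Sy],\quad f_x=[Sx,x],\quad f_y=[Sy,y],\quad \zeta=D^*a,$$ $$\delta_3(x,y)=-B(a,b)+\tfrac34B(Sa,a)+\tfrac14B(Sh,h)-B(Sf_x,f_y).$$ Define $$\mathcal I=\{(g,x,y): g\in G,\ x,y\in\mathfrak g,\ J_g^*x=J_g^*y=0,\ |x|=|y|=1,\ B(x,y)=0\},$$ $$\mathcal Z=\{(g,x,y)\in\mathcal I: c=0,\ \zeta=0\}.$$ *)

theory Defs
  imports "HOL-Analysis.Analysis"
begin

datatype quat = Quat (qRe: real) (qI: real) (qJ: real) (qK: real)

lemma quat_eq_iff: "p = q \<longleftrightarrow> qRe p = qRe q \<and> qI p = qI q \<and> qJ p = qJ q \<and> qK p = qK q"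
  by (cases p; cases q) simp

instantiation quat :: real_algebra_1
begin

definition zero_quat :: quat where "0 = Quat 0 0 0 0"
definition one_quat :: quat where "1 = Quat 1 0 0 0"
definition plus_quat :: "quat \<Rightarrow> quat \<Rightarrow> quat" where
  "p + q = Quat (qRe p + qRe q) (qI p + qI q) (qJ p + qJ q) (qK p + qK q)"
definition uminus_quat :: "quat \<Rightarrow> quat" where
  "- p = Quat (- qRe p) (- qI p) (- qJ p) (- qK p)"
definition minus_quat :: "quat \<Rightarrow> quat \<Rightarrow> quat" where
  "p - q = Quat (qRe p - qRe q) (qI p - qI q) (qJ p - qJ q) (qK p - qK q)"
definition scaleR_quat :: "real \<Rightarrow> quat \<Rightarrow> quat" where
  "t *\<^sub>R p = Quat (t * qRe p) (t * qI p) (t * qJ p) (t * qK p)"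
definition times_quat :: "quat \<Rightarrow> quat \<Rightarrow> quat" where
  "p * q = Quat
     (qRe p * qRe q - qI p * qI q - qJ p * qJ q - qK p * qK q)
     (qRe p * qI q + qI p * qRe q + qJ p * qK q - qK p * qJ q)
     (qRe p * qJ q - qI p * qK q + qJ p * qRe q + qK p * qI q)
     (qRe p * qK q + qI p * qJ q - qJ p * qI q + qK p * qRe q)"

instance
  by standard
    (simp_all add: quat_eq_iff zero_quat_def one_quat_def plus_quat_def uminus_quat_def
      minus_quat_def scaleR_quat_def times_quat_def algebra_simps)

end

lemma quat_sel [simp]:
  "qRe 0 = 0" "qI 0 = 0" "qJ 0 = 0" "qK 0 = 0"
  "qRe 1 = 1" "qI 1 = 0" "qJ 1 = 0" "qK 1 = 0"
  "qRe (p + q) = qRe p + qRe q" "qI (p + q) = qI p + qI q"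
  "qJ (p + q) = qJ p + qJ q" "qK (p + q) = qK p + qK q"
  "qRe (- p) = - qRe p" "qI (- p) = - qI p" "qJ (- p) = - qJ p" "qK (- p) = - qK p"
  "qRe (p - q) = qRe p - qRe q" "qI (p - q) = qI p - qI q"
  "qJ (p - q) = qJ p - qJ q" "qK (p - q) = qK p - qK q"
  "qRe (t *\<^sub>R p) = t * qRe p" "qI (t *\<^sub>R p) = t * qI p"
  "qJ (t *\<^sub>R p) = t * qJ p" "qK (t *\<^sub>R p) = t * qK p"
  "qRe (p * q) = qRe p * qRe q - qI p * qI q - qJ p * qJ q - qK p * qK q"
  "qI (p * q) = qRe p * qI q + qI p * qRe q + qJ p * qK q - qK p * qJ q"
  "qJ (p * q) = qRe p * qJ q - qI p * qK q + qJ p * qRe q + qK p * qI q"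
  "qK (p * q) = qRe p * qK q + qI p * qJ q - qJ p * qI q + qK p * qRe q"
  by (simp_all add: zero_quat_def one_quat_def plus_quat_def uminus_quat_def
      minus_quat_def scaleR_quat_def times_quat_def)

lemma quat_of_real_sel [simp]:
  "qRe (of_real t) = t" "qI (of_real t) = 0" "qJ (of_real t) = 0" "qK (of_real t) = 0"
  by (simp_all add: of_real_def)

definition qcnj :: "quat \<Rightarrow> quat" where
  "qcnj p = Quat (qRe p) (- qI p) (- qJ p) (- qK p)"

lemma qcnj_sel [simp]:
  "qRe (qcnj p) = qRe p" "qI (qcnj p) = - qI p" "qJ (qcnj p) = - qJ p" "qK (qcnj p) = - qK p"
  by (simp_all add: qcnj_def)

definition ImH :: "quat set" where
  "ImH = {u. qRe u = 0}"

definition im_dot :: "quat \<Rightarrow> quat \<Rightarrow> real" where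
  "im_dot u v = - qRe (u * v)"


type_synonym qmat = "quat^2^2"

definition mat22 :: "quat \<Rightarrow> quat \<Rightarrow> quat \<Rightarrow> quat \<Rightarrow> qmat" where
  "mat22 p q s t = vector [vector [p, q], vector [s, t]]"

lemma mat22_nth [simp]:
  "mat22 p q s t $ 1 $ 1 = p" "mat22 p q s t $ 1 $ 2 = q"
  "mat22 p q s t $ 2 $ 1 = s" "mat22 p q s t $ 2 $ 2 = t"
  by (simp_all add: mat22_def)

lemma qmat_eq_iff:
  "(A :: qmat) = A' \<longleftrightarrow> A $ 1 $ 1 = A' $ 1 $ 1 \<and> A $ 1 $ 2 = A' $ 1 $ 2 \<and>
     A $ 2 $ 1 = A' $ 2 $ 1 \<and> A $ 2 $ 2 = A' $ 2 $ 2"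
  by (auto simp: vec_eq_iff forall_2)

definition conj_transpose :: "qmat \<Rightarrow> qmat" where
  "conj_transpose A = (\<chi> i j. qcnj (A $ j $ i))"

definition Sp2 :: "qmat set" where
  "Sp2 = {Q. Q ** conj_transpose Q = mat 1 \<and> conj_transpose Q ** Q = mat 1}"

definition sp2 :: "qmat set" where
  "sp2 = {A. conj_transpose A + A = 0}"

definition commutator :: "qmat \<Rightarrow> qmat \<Rightarrow> qmat" where
  "commutator U V = U ** V - V ** U"

definition sp2_inner :: "qmat \<Rightarrow> qmat \<Rightarrow> real" where
  "sp2_inner U V = - (1/2) * qRe (trace (U ** V))"

definition sp2_norm :: "qmat \<Rightarrow> real" where
  "sp2_norm U = sqrt (sp2_inner U U)"

definition sp2_elem :: "real \<Rightarrow> quat \<Rightarrow> quat \<Rightarrow> quat \<Rightarrow> qmat" where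
  "sp2_elem r u0 u1 u2 =
     mat22 (u0 + u1) (of_real r + u2) (- of_real r + u2) (u0 - u1)"

text \<open>
  The coordinates \<open>(r; u0, u1, u2)\<close> of an element of \<open>sp2\<close>, read off from the matrix entries;
  \<open>sp2_elem_coords\<close> and \<open>coords_sp2_elem\<close> give existence and uniqueness.  On matrices outside
  \<open>sp2\<close> these functions, and hence \<open>S\<close>, have no meaning and are not used.
\<close>

definition coord_r :: "qmat \<Rightarrow> real" where "coord_r A = qRe (A $ 1 $ 2)"
definition coord_u0 :: "qmat \<Rightarrow> quat" where "coord_u0 A = (1/2) *\<^sub>R (A $ 1 $ 1 + A $ 2 $ 2)"
definition coord_u1 :: "qmat \<Rightarrow> quat" where "coord_u1 A = (1/2) *\<^sub>R (A $ 1 $ 1 - A $ 2 $ 2)"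
definition coord_u2 :: "qmat \<Rightarrow> quat" where "coord_u2 A = A $ 1 $ 2 - of_real (qRe (A $ 1 $ 2))"

lemma sp2_iff:
  "A \<in> sp2 \<longleftrightarrow> qRe (A $ 1 $ 1) = 0 \<and> qRe (A $ 2 $ 2) = 0 \<and> A $ 2 $ 1 = - qcnj (A $ 1 $ 2)"
  by (auto simp: sp2_def conj_transpose_def qmat_eq_iff quat_eq_iff)

lemma sp2_elem_in_sp2:
  "\<lbrakk>u0 \<in> ImH; u1 \<in> ImH; u2 \<in> ImH\<rbrakk> \<Longrightarrow> sp2_elem r u0 u1 u2 \<in> sp2"
  by (simp add: sp2_iff sp2_elem_def ImH_def quat_eq_iff)

lemma sp2_elem_coords:
  assumes "A \<in> sp2"
  shows "sp2_elem (coord_r A) (coord_u0 A) (coord_u1 A) (coord_u2 A) = A"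
    and "coord_u0 A \<in> ImH" "coord_u1 A \<in> ImH" "coord_u2 A \<in> ImH"
  using assms
  by (simp_all add: sp2_iff sp2_elem_def ImH_def qmat_eq_iff quat_eq_iff
      coord_r_def coord_u0_def coord_u1_def coord_u2_def field_simps)

lemma coords_sp2_elem:
  assumes "u0 \<in> ImH" "u1 \<in> ImH" "u2 \<in> ImH"
  shows "coord_r (sp2_elem r u0 u1 u2) = r" "coord_u0 (sp2_elem r u0 u1 u2) = u0"
    "coord_u1 (sp2_elem r u0 u1 u2) = u1" "coord_u2 (sp2_elem r u0 u1 u2) = u2"
  using assms
  by (simp_all add: sp2_elem_def ImH_def quat_eq_iff
      coord_r_def coord_u0_def coord_u1_def coord_u2_def)

definition S :: "qmat \<Rightarrow> qmat" where
  "S A = sp2_elem (3 * coord_r A) (coord_u1 A) (coord_u0 A - coord_u2 A) (- coord_u1 A)"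

lemma S_sp2_elem:
  assumes "u0 \<in> ImH" "u1 \<in> ImH" "u2 \<in> ImH"
  shows "S (sp2_elem r u0 u1 u2) = sp2_elem (3 * r) u1 (u0 - u2) (- u1)"
  using assms by (simp add: S_def coords_sp2_elem)


definition D :: "quat \<Rightarrow> qmat" where
  "D \<xi> = mat22 \<xi> 0 0 \<xi>"

definition E :: "qmat \<Rightarrow> quat \<Rightarrow> qmat" where
  "E g \<xi> = g ** mat22 \<xi> 0 0 0 ** conj_transpose g"

definition J :: "qmat \<Rightarrow> quat \<Rightarrow> qmat" where
  "J g \<xi> = D \<xi> - E g \<xi>"

text \<open>
  The library's adjoint lives on whole types with their \<open>real_inner\<close> structure; here the domain
  is the subspace \<open>ImH\<close> and the codomain \<open>sp2\<close> carries the product \<open>sp2_inner\<close>.  The definite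
  description is justified by \<open>ex1_im_adjoint\<close> below.
\<close>

definition im_adjoint :: "(quat \<Rightarrow> qmat) \<Rightarrow> qmat \<Rightarrow> quat" where
  "im_adjoint T x = (THE v. v \<in> ImH \<and> (\<forall>\<xi>\<in>ImH. im_dot v \<xi> = sp2_inner x (T \<xi>)))"

lemmas qmat_mult_nth = matrix_matrix_mult_def sum_2

lemma sp2_inner_add_right: "sp2_inner x (U + V) = sp2_inner x U + sp2_inner x V"
  by (simp add: sp2_inner_def trace_def qmat_mult_nth algebra_simps)

lemma sp2_inner_scaleR_right: "sp2_inner x (t *\<^sub>R U) = t * sp2_inner x U"
  by (simp add: sp2_inner_def trace_def qmat_mult_nth algebra_simps)

lemma ex1_im_adjoint:
  assumes "linear T"
  shows "\<exists>!v. v \<in> ImH \<and> (\<forall>\<xi>\<in>ImH. im_dot v \<xi> = sp2_inner x (T \<xi>))"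
proof (rule ex1I)
  define b where "b \<xi> = sp2_inner x (T \<xi>)" for \<xi>
  let ?i = "Quat 0 1 0 0" and ?j = "Quat 0 0 1 0" and ?k = "Quat 0 0 0 1"
  have b_lin: "b \<xi> = qI \<xi> * b ?i + qJ \<xi> * b ?j + qK \<xi> * b ?k" if "\<xi> \<in> ImH" for \<xi>
  proof -
    have "\<xi> = qI \<xi> *\<^sub>R ?i + qJ \<xi> *\<^sub>R ?j + qK \<xi> *\<^sub>R ?k"
      using that by (simp add: quat_eq_iff ImH_def)
    then have "b \<xi> = b (qI \<xi> *\<^sub>R ?i + qJ \<xi> *\<^sub>R ?j + qK \<xi> *\<^sub>R ?k)"
      by simp
    then show ?thesis
      by (simp add: b_def linear_add[OF assms] linear_scale[OF assms]
          sp2_inner_add_right sp2_inner_scaleR_right)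
  qed
  have "im_dot (Quat 0 (b ?i) (b ?j) (b ?k)) \<xi> = b \<xi>" if "\<xi> \<in> ImH" for \<xi>
    using b_lin[OF that] that by (simp add: ImH_def im_dot_def mult.commute)
  then show "Quat 0 (b ?i) (b ?j) (b ?k) \<in> ImH \<and>
    (\<forall>\<xi>\<in>ImH. im_dot (Quat 0 (b ?i) (b ?j) (b ?k)) \<xi> = sp2_inner x (T \<xi>))"
    by (simp add: ImH_def b_def)
  fix v assume v: "v \<in> ImH \<and> (\<forall>\<xi>\<in>ImH. im_dot v \<xi> = sp2_inner x (T \<xi>))"
  then have "im_dot v ?i = b ?i" "im_dot v ?j = b ?j" "im_dot v ?k = b ?k"
    by (simp_all add: b_def ImH_def)
  with v show "v = Quat 0 (b ?i) (b ?j) (b ?k)"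
    by (simp add: quat_eq_iff im_dot_def ImH_def)
qed

lemma linear_D: "linear D"
  by (rule linearI) (simp_all add: D_def qmat_eq_iff)

lemma linear_J: "linear (J g)"
  by (rule linearI)
    (simp_all add: J_def D_def E_def qmat_eq_iff qmat_mult_nth algebra_simps)

lemma im_adjoint_D:
  assumes "u0 \<in> ImH" "u1 \<in> ImH" "u2 \<in> ImH"
  shows "im_adjoint D (sp2_elem r u0 u1 u2) = u0"
  unfolding im_adjoint_def
  by (rule the1_equality[OF ex1_im_adjoint[OF linear_D]])
    (use assms in \<open>auto simp: ImH_def im_dot_def sp2_inner_def trace_def qmat_mult_nth
        sp2_elem_def D_def algebra_simps\<close>)


definition a_term :: "qmat \<Rightarrow> qmat \<Rightarrow> qmat" where
  "a_term x y = commutator (S x) y + commutator x (S y)"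

definition b_term :: "qmat \<Rightarrow> qmat \<Rightarrow> qmat" where
  "b_term x y = commutator (S x) (S y)"

definition h_term :: "qmat \<Rightarrow> qmat \<Rightarrow> qmat" where
  "h_term x y = commutator (S x) y - commutator x (S y)"

definition f_term :: "qmat \<Rightarrow> qmat" where
  "f_term x = commutator (S x) x"

definition zeta :: "qmat \<Rightarrow> qmat \<Rightarrow> quat" where
  "zeta x y = im_adjoint D (a_term x y)"

definition delta3 :: "qmat \<Rightarrow> qmat \<Rightarrow> real" where
  "delta3 x y =
     - sp2_inner (a_term x y) (b_term x y)
     + 3/4 * sp2_inner (S (a_term x y)) (a_term x y)
     + 1/4 * sp2_inner (S (h_term x y)) (h_term x y)
     - sp2_inner (S (f_term x)) (f_term y)"

definition I_set :: "(qmat \<times> qmat \<times> qmat) set" where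
  "I_set = {(g, x, y). g \<in> Sp2 \<and> x \<in> sp2 \<and> y \<in> sp2 \<and>
     im_adjoint (J g) x = 0 \<and> im_adjoint (J g) y = 0 \<and>
     sp2_norm x = 1 \<and> sp2_norm y = 1 \<and> sp2_inner x y = 0}"

definition Z_set :: "(qmat \<times> qmat \<times> qmat) set" where
  "Z_set = {(g, x, y) \<in> I_set. commutator x y = 0 \<and> zeta x y = 0}"

end

theory Submission
  imports Defs
begin

text \<open>
  Write \<open>x = (r; u0, u1, u2)\<close> and \<open>y = (s; v0, v1, v2)\<close>. For given \<open>g\<close>, the conditions on
  \<open>x\<close> and \<open>y\<close> and the value of \<open>\<delta>\<^sub>3\<close> depend only on the plane which they span, so its
  orthonormal basis may be rotated. The proof chooses a good basis, brings the six vectors into a normal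
  form, and is left with an inequality for a function of one parameter.

  \<^item> The basis. The matrices \<open>x\<^sup>2 + 1\<close> and \<open>x y\<close> are commuting trace-free Hermitian matrices and
    hence parallel in \<open>\<real>\<^sup>5\<close>, so some rotation achieves \<open>x\<^sup>2 = y\<^sup>2 = - 1\<close>
    (\<open>rotate_to_square_roots\<close>). Then \<open>u0\<close> is orthogonal to \<open>u1\<close> and \<open>u2\<close>, and
    \<open>u1 \<times> u2 = - r u0\<close>; similarly for \<open>y\<close>.

  \<^item> The condition on \<open>g\<close>. It says that \<open>z\<^sup>* x z = 2 u0\<close> and \<open>z\<^sup>* y z = 2 v0\<close> for the first
    column \<open>z\<close> of \<open>g\<close>, a unit vector (\<open>horizontal_moment\<close>). In particular no nonzero
    \<open>(0; w, 0, 0)\<close> lies in the plane, as \<open>z\<^sup>* w z\<close> is at most as long as \<open>w\<close>. Moreover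
    \<open>x + y\<close> and \<open>x - y\<close> have rank one, which makes \<open>|z\<^sup>* (x + y) z| + |z\<^sup>* (x - y) z|\<close> equal
    to \<open>2\<close>; so \<open>|u0|\<^sup>2 + |v0|\<^sup>2 = 1/4\<close> as soon as \<open>u0\<close> and \<open>v0\<close> are orthogonal
    (\<open>moment_norms\<close>).

  \<^item> The condition \<open>\<zeta> = 0\<close>. Together with \<open>c = 0\<close> it forces \<open>r = s = 0\<close>, since otherwise the
    plane would contain some \<open>(0; w, 0, 0)\<close> (\<open>zeta_zero_forces_scalar\<close>). Then
    \<open>u1 = p e\<close>, \<open>u2 = q e\<close>, \<open>v1 = p' f\<close>, \<open>v2 = q' f\<close> with unit vectors \<open>e\<close> and \<open>f\<close>, and the
    equations make \<open>e\<close> and \<open>f\<close> orthogonal (\<open>plane_directions_orthogonal\<close>), with \<open>u0 = a f\<close> and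
    \<open>v0 = - b e\<close>. What remains of \<open>c = 0\<close> and \<open>\<zeta> = 0\<close> is \<open>a b + p p' + q q' = 0\<close> and
    \<open>p q' + q p' = 0\<close>.

  In this normal form \<open>\<delta>\<^sub>3\<close> is a polynomial in \<open>a, b, p, q, p', q'\<close> (\<open>delta3_normal_form\<close>), and the
  constraints with \<open>a\<^sup>2 + b\<^sup>2 = 1/4\<close> bound it below (\<open>normal_form_lower_bound\<close>).
\<close>

unbundle cross3_syntax

section \<open>Quaternions, quaternionic matrices and columns\<close>

lemma quat_numeral_sel [simp]:
  "qRe (numeral n) = numeral n" "qI (numeral n) = 0" "qJ (numeral n) = 0" "qK (numeral n) = 0"
  using quat_of_real_sel[of "numeral n"] by simp_all

lemma qcnj_simps [simp]: "qcnj (p * q) = qcnj q * qcnj p" "qcnj (qcnj p) = p"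
  "qcnj (p + q) = qcnj p + qcnj q" "qcnj (p - q) = qcnj p - qcnj q" "qcnj (t *\<^sub>R p) = t *\<^sub>R qcnj p"
  "qcnj (- p) = - qcnj p" "qcnj 0 = 0" "qcnj 1 = 1"
  by (simp_all add: quat_eq_iff algebra_simps)

lemma qRe_commute: "qRe (p * q) = qRe (q * p)"
  by (simp add: algebra_simps)

text \<open>
  The squared norm of a quaternion; multiplicativity makes it enough for all estimates.
\<close>

definition qsq :: "quat \<Rightarrow> real" where
  "qsq p = (qRe p)\<^sup>2 + (qI p)\<^sup>2 + (qJ p)\<^sup>2 + (qK p)\<^sup>2"

lemma qsq_simps [simp]: "qsq (qcnj p) = qsq p" "qsq (t *\<^sub>R p) = t\<^sup>2 * qsq p"
  by (simp_all add: qsq_def algebra_simps power_mult_distrib)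

lemma qsq_mult: "qsq (p * q) = qsq p * qsq q"
  by (simp add: qsq_def) algebra

lemma qsq_0_iff: "qsq p = 0 \<longleftrightarrow> p = 0"
  by (simp add: qsq_def quat_eq_iff add_nonneg_eq_0_iff)

lemma qcnj_mult_self: "qcnj p * p = of_real (qsq p)" "p * qcnj p = of_real (qsq p)"
  by (simp_all add: quat_eq_iff qsq_def power2_eq_square algebra_simps)

lemma qmat_bilinear:
  fixes A B C :: qmat
  shows "(A + B) ** C = A ** C + B ** C" "A ** (B + C) = A ** B + A ** C"
    "(A - B) ** C = A ** C - B ** C" "A ** (B - C) = A ** B - A ** C"
    "(- A) ** B = - (A ** B)" "A ** (- B) = - (A ** B)"
    "(t *\<^sub>R A) ** B = t *\<^sub>R (A ** B)" "A ** (t *\<^sub>R B) = t *\<^sub>R (A ** B)"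
  by (simp_all add: qmat_eq_iff qmat_mult_nth algebra_simps)

lemma conj_transpose_simps:
  "conj_transpose (A ** B) = conj_transpose B ** conj_transpose A"
  "conj_transpose (A + B) = conj_transpose A + conj_transpose B"
  "conj_transpose (A - B) = conj_transpose A - conj_transpose B"
  "conj_transpose (t *\<^sub>R A) = t *\<^sub>R conj_transpose A"
  "conj_transpose (mat 1) = mat 1"
  by (simp_all add: qmat_eq_iff conj_transpose_def qmat_mult_nth mat_def)

lemma conj_transpose_sp2: "A \<in> sp2 \<Longrightarrow> conj_transpose A = - A"
  by (simp add: sp2_def eq_neg_iff_add_eq_0)

text \<open>
  The standard Hermitian form on the right quaternionic space of column pairs, so that
  \<open>hip p (A *v p)\<close> is \<open>p\<^sup>* A p\<close>.
\<close>

definition hip :: "quat^2 \<Rightarrow> quat^2 \<Rightarrow> quat" where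
  "hip u v = qcnj (u $ 1) * v $ 1 + qcnj (u $ 2) * v $ 2"

lemma matvec_nth: "((A::qmat) *v u) $ i = A $ i $ 1 * u $ 1 + A $ i $ 2 * u $ 2"
  by (simp add: matrix_vector_mult_def sum_2)

lemma matvec_linear:
  fixes A B :: qmat
  shows "(A + B) *v u = A *v u + B *v u" "(A - B) *v u = A *v u - B *v u"
    "(- A) *v u = - (A *v u)" "(t *\<^sub>R A) *v u = t *\<^sub>R (A *v u)"
  by (simp_all add: vec_eq_iff matvec_nth algebra_simps)

lemma hip_adjoint: "hip u (A *v v) = hip (conj_transpose A *v u) v"
  by (simp add: hip_def matvec_nth conj_transpose_def algebra_simps)

lemma hip_linear:
  "hip u (v + w) = hip u v + hip u w" "hip u (v - w) = hip u v - hip u w"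
  "hip u (t *\<^sub>R v) = t *\<^sub>R hip u v" "hip u (- v) = - hip u v" "hip (- u) v = - hip u v"
  by (simp_all add: hip_def algebra_simps)

lemma hip_self: "hip u u = of_real (qsq (u $ 1) + qsq (u $ 2))"
  by (simp add: hip_def qcnj_mult_self)

text \<open>
  \<open>P\<close> is the orthogonal projection onto a quaternionic line, by its trace, and on a line the
  Cauchy-Schwarz inequality is an equality. Either the first coordinate of every vector in the
  image is zero, or the second is a fixed multiple \<open>\<gamma>\<close> of the first.
\<close>

lemma qsq_hip_line:
  assumes herm: "conj_transpose P = P" and tr: "qRe (P $ 1 $ 1) + qRe (P $ 2 $ 2) = 1"
    and idem: "P ** P = P" and u: "P *v u = u" and v: "P *v v = v"
  shows "qsq (hip u v) = qRe (hip u u) * qRe (hip v v)"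
proof -
  define \<alpha> \<beta> where "\<alpha> = qRe (P $ 1 $ 1)" and "\<beta> = P $ 1 $ 2"
  have herm': "qcnj (P $ j $ i) = P $ i $ j" for i j
    using arg_cong[OF herm, of "\<lambda>A. A $ i $ j"] by (simp add: conj_transpose_def)
  have P11: "P $ 1 $ 1 = of_real \<alpha>" and P22: "P $ 2 $ 2 = of_real (1 - \<alpha>)"
    using herm'[of 1 1] herm'[of 2 2] tr by (auto simp: quat_eq_iff \<alpha>_def)
  have P21: "P $ 2 $ 1 = qcnj \<beta>" using herm'[of 1 2] by (simp add: \<beta>_def)
  have "(P ** P) $ 1 $ 1 = P $ 1 $ 1" by (simp add: idem)
  then have b: "\<alpha>\<^sup>2 + qsq \<beta> = \<alpha>"
    by (simp add: qmat_mult_nth P11 P21 flip: \<beta>_def)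
      (simp add: qcnj_mult_self flip: of_real_mult of_real_add, simp add: power2_eq_square)
  have line: "\<alpha> *\<^sub>R w $ 2 = qcnj \<beta> * w $ 1" "(1 - \<alpha>) *\<^sub>R w $ 1 = \<beta> * w $ 2" if "P *v w = w" for w
    using arg_cong[OF that, of "\<lambda>z. z $ 1"] arg_cong[OF that, of "\<lambda>z. z $ 2"]
    by (simp_all add: matvec_nth P11 P22 P21 scaleR_conv_of_real algebra_simps flip: \<beta>_def)
  show ?thesis
  proof (cases "\<alpha> = 0")
    case True
    then have "\<beta> = 0" using b by (simp add: qsq_0_iff)
    then have "u $ 1 = 0" "v $ 1 = 0" using line(2)[OF u] line(2)[OF v] True by simp_all
    then show ?thesis by (simp add: hip_self hip_def[of u v] qsq_mult) (simp add: qsq_def)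
  next
    case False
    define \<gamma> where "\<gamma> = (1 / \<alpha>) *\<^sub>R qcnj \<beta>"
    have 2: "w $ 2 = \<gamma> * w $ 1" if "P *v w = w" for w
    proof -
      have "w $ 2 = (1 / \<alpha>) *\<^sub>R \<alpha> *\<^sub>R w $ 2" using False by simp
      also have "\<dots> = \<gamma> * w $ 1" unfolding line(1)[OF that] \<gamma>_def by simp
      finally show ?thesis .
    qed
    have "hip u v = (1 + qsq \<gamma>) *\<^sub>R (qcnj (u $ 1) * v $ 1)"
    proof -
      have "qcnj (u $ 2) * v $ 2 = qcnj (u $ 1) * (qcnj \<gamma> * \<gamma>) * v $ 1"
        by (simp add: 2[OF u] 2[OF v] mult.assoc)
      also have "\<dots> = qsq \<gamma> *\<^sub>R (qcnj (u $ 1) * v $ 1)"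
        by (simp add: qcnj_mult_self scaleR_conv_of_real[symmetric] of_real_def)
      finally show ?thesis by (simp add: hip_def algebra_simps)
    qed
    moreover have "qRe (hip w w) = (1 + qsq \<gamma>) * qsq (w $ 1)" if "P *v w = w" for w
      by (simp add: hip_self 2[OF that] qsq_mult algebra_simps del: of_real_add of_real_mult)
    ultimately show ?thesis using u v
      by (simp add: qsq_mult power2_eq_square)
  qed
qed

section \<open>Coordinates by vectors of three-space\<close>

definition imq :: "real^3 \<Rightarrow> quat" where
  "imq v = Quat 0 (v $ 1) (v $ 2) (v $ 3)"

lemma imq_sel [simp]:
  "qRe (imq v) = 0" "qI (imq v) = v $ 1" "qJ (imq v) = v $ 2" "qK (imq v) = v $ 3"
  by (simp_all add: imq_def)

lemma imq_in_ImH [simp]: "imq v \<in> ImH"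
  by (simp add: ImH_def)

lemma imq_inject [simp]: "imq u = imq v \<longleftrightarrow> u = v"
  by (auto simp: quat_eq_iff vec_eq_iff forall_3)

lemma imq_exhaust:
  assumes "q \<in> ImH" obtains v where "q = imq v"
proof
  show "q = imq (vector [qI q, qJ q, qK q])"
    using assms by (simp add: quat_eq_iff ImH_def)
qed

lemma imq_linear [simp]:
  "imq 0 = 0" "imq u + imq v = imq (u + v)" "imq u - imq v = imq (u - v)"
  "- imq u = imq (- u)" "t *\<^sub>R imq u = imq (t *\<^sub>R u)"
  by (simp_all add: quat_eq_iff)

lemma qsq_imq [simp]: "qsq (imq u) = u \<bullet> u"
  by (simp add: qsq_def inner_vec_def sum_3 power2_eq_square)

text \<open>
  Taking the three imaginary quaternions as vectors of \<open>real^3\<close> turns quaternion products into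
  dot and cross products, because \<open>u v = - (u \<bullet> v) + u \<times> v\<close>.
\<close>

definition el :: "real \<Rightarrow> real^3 \<Rightarrow> real^3 \<Rightarrow> real^3 \<Rightarrow> qmat" where
  "el r u0 u1 u2 = sp2_elem r (imq u0) (imq u1) (imq u2)"

lemma el_nth [simp]:
  "el r u0 u1 u2 $ 1 $ 1 = imq (u0 + u1)" "el r u0 u1 u2 $ 1 $ 2 = of_real r + imq u2"
  "el r u0 u1 u2 $ 2 $ 1 = - of_real r + imq u2" "el r u0 u1 u2 $ 2 $ 2 = imq (u0 - u1)"
  by (simp_all add: el_def sp2_elem_def)

lemma el_in_sp2 [simp]: "el r u0 u1 u2 \<in> sp2"
  by (simp add: el_def sp2_elem_in_sp2)

lemma el_exhaust:
  assumes "A \<in> sp2" obtains r u0 u1 u2 where "A = el r u0 u1 u2"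
  using sp2_elem_coords[OF assms] imq_exhaust unfolding el_def by metis

lemma el_linear:
  "el r u0 u1 u2 + el s v0 v1 v2 = el (r + s) (u0 + v0) (u1 + v1) (u2 + v2)"
  "el r u0 u1 u2 - el s v0 v1 v2 = el (r - s) (u0 - v0) (u1 - v1) (u2 - v2)"
  "- el r u0 u1 u2 = el (- r) (- u0) (- u1) (- u2)"
  "t *\<^sub>R el r u0 u1 u2 = el (t * r) (t *\<^sub>R u0) (t *\<^sub>R u1) (t *\<^sub>R u2)"
  by (simp_all add: qmat_eq_iff quat_eq_iff algebra_simps)

lemma el_eq_iff:
  "el r u0 u1 u2 = el s v0 v1 v2 \<longleftrightarrow> r = s \<and> u0 = v0 \<and> u1 = v1 \<and> u2 = v2"
  by (auto simp: qmat_eq_iff quat_eq_iff vec_eq_iff forall_3)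

lemma el_0: "el 0 0 0 0 = 0"
  by (simp add: qmat_eq_iff quat_eq_iff)

lemma S_el: "S (el r u0 u1 u2) = el (3 * r) u1 (u0 - u2) (- u1)"
  by (simp add: el_def S_sp2_elem)

lemma sp2_inner_el:
  "sp2_inner (el r u0 u1 u2) (el s v0 v1 v2) = r * s + u0 \<bullet> v0 + u1 \<bullet> v1 + u2 \<bullet> v2"
  by (simp add: sp2_inner_def trace_def sum_2 qmat_mult_nth inner_vec_def sum_3 field_simps)

lemma commutator_el:
  "commutator (el r u0 u1 u2) (el s v0 v1 v2) = el
     (2 * (u2 \<bullet> v1 - u1 \<bullet> v2))
     (2 *\<^sub>R (u0 \<times> v0 + u1 \<times> v1 + u2 \<times> v2))
     (2 *\<^sub>R (u0 \<times> v1 + u1 \<times> v0 + r *\<^sub>R v2 - s *\<^sub>R u2))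
     (2 *\<^sub>R (u0 \<times> v2 + u2 \<times> v0 - r *\<^sub>R v1 + s *\<^sub>R u1))"
  by (simp add: commutator_def qmat_eq_iff quat_eq_iff qmat_mult_nth cross_components
      inner_vec_def sum_3 algebra_simps)

lemma zeta_el:
  "zeta (el r u0 u1 u2) (el s v0 v1 v2) =
     imq (4 *\<^sub>R (u0 \<times> v1 + u1 \<times> v0 - u1 \<times> v2 - u2 \<times> v1))"
proof -
  have "im_adjoint D (el t w0 w1 w2) = imq w0" for t w0 w1 w2
    by (simp add: el_def im_adjoint_D)
  then show ?thesis
    by (simp add: zeta_def a_term_def S_el commutator_el el_linear)
      (simp add: cross3_simps)
qed

text \<open>
  The square of an element of \<open>sp2\<close> is Hermitian, and its trace-free part has the coordinates
  \<open>u0 \<bullet> u1\<close>, \<open>u0 \<bullet> u2\<close> and \<open>r u0 + u1 \<times> u2\<close>, up to factors; they vanish when the square is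
  scalar.
\<close>

lemma el_square_scalar:
  assumes "el r u0 u1 u2 ** el r u0 u1 u2 = - mat 1"
  shows "u0 \<bullet> u1 = 0" "u0 \<bullet> u2 = 0" "u1 \<times> u2 = - r *\<^sub>R u0"
proof -
  let ?A = "el r u0 u1 u2"
  have eq: "(?A ** ?A) $ i $ j = (- mat 1) $ i $ j" for i j
    using assms by simp
  show "u0 \<bullet> u1 = 0"
    using arg_cong[OF eq[of 1 1], of qRe] arg_cong[OF eq[of 2 2], of qRe]
    by (simp add: qmat_mult_nth mat_def inner_vec_def sum_3 algebra_simps)
  show "u0 \<bullet> u2 = 0"
    using arg_cong[OF eq[of 1 2], of qRe]
    by (simp add: qmat_mult_nth mat_def inner_vec_def sum_3 algebra_simps)
  show "u1 \<times> u2 = - r *\<^sub>R u0"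
    using arg_cong[OF eq[of 1 2], of qI] arg_cong[OF eq[of 1 2], of qJ] arg_cong[OF eq[of 1 2], of qK]
    by (simp add: qmat_mult_nth mat_def vec_eq_iff forall_3 cross_components algebra_simps)
qed

section \<open>Dependence on the plane only\<close>

lemma sp2_inner_linear:
  "sp2_inner (U + V) W = sp2_inner U W + sp2_inner V W"
  "sp2_inner (U - V) W = sp2_inner U W - sp2_inner V W"
  "sp2_inner (t *\<^sub>R U) W = t * sp2_inner U W"
  "sp2_inner W (U + V) = sp2_inner W U + sp2_inner W V"
  "sp2_inner W (U - V) = sp2_inner W U - sp2_inner W V"
  "sp2_inner W (t *\<^sub>R U) = t * sp2_inner W U"
  by (simp_all add: sp2_inner_def trace_def sum_2 qmat_mult_nth algebra_simps)

lemma sp2_inner_commute: "sp2_inner U V = sp2_inner V U"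
  by (simp add: sp2_inner_def trace_def sum_2 qmat_mult_nth algebra_simps)

lemma S_linear: "S (A + B) = S A + S B" "S (A - B) = S A - S B" "S (t *\<^sub>R A) = t *\<^sub>R S A"
  by (simp_all add: S_def sp2_elem_def coord_r_def coord_u0_def coord_u1_def coord_u2_def
      qmat_eq_iff quat_eq_iff algebra_simps)

lemma commutator_linear:
  "commutator (A + B) C = commutator A C + commutator B C"
  "commutator C (A + B) = commutator C A + commutator C B"
  "commutator (A - B) C = commutator A C - commutator B C"
  "commutator C (A - B) = commutator C A - commutator C B"
  "commutator (t *\<^sub>R A) B = t *\<^sub>R commutator A B"
  "commutator A (t *\<^sub>R B) = t *\<^sub>R commutator A B"
  by (simp_all add: commutator_def qmat_bilinear algebra_simps)

lemma commutator_skew: "commutator A B = - commutator B A" "commutator A A = 0"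
  by (simp_all add: commutator_def)

text \<open>
  The terms \<open>a\<close>, \<open>b\<close>, \<open>c\<close> and \<open>\<zeta>\<close> are alternating bilinear in \<open>(x, y)\<close>, so a change of basis
  multiplies them by its determinant, here \<open>c\<^sup>2 + s\<^sup>2\<close>.
\<close>

lemma a_term_rotate: "a_term (c *\<^sub>R x + s *\<^sub>R y) (c *\<^sub>R y - s *\<^sub>R x) = (c\<^sup>2 + s\<^sup>2) *\<^sub>R a_term x y"
  unfolding a_term_def S_linear commutator_linear
  using commutator_skew(1)[of "S y" x] commutator_skew(1)[of y "S x"]
    commutator_skew(1)[of "S x" x] commutator_skew(1)[of "S y" y]
  by (simp add: algebra_simps power2_eq_square)

lemma b_term_rotate: "b_term (c *\<^sub>R x + s *\<^sub>R y) (c *\<^sub>R y - s *\<^sub>R x) = (c\<^sup>2 + s\<^sup>2) *\<^sub>R b_term x y"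
  unfolding b_term_def S_linear commutator_linear
  using commutator_skew(1)[of "S y" "S x"]
  by (simp add: algebra_simps power2_eq_square commutator_skew(2))

lemma commutator_rotate:
  "commutator (c *\<^sub>R x + s *\<^sub>R y) (c *\<^sub>R y - s *\<^sub>R x) = (c\<^sup>2 + s\<^sup>2) *\<^sub>R commutator x y"
  unfolding commutator_linear
  using commutator_skew(1)[of y x]
  by (simp add: algebra_simps power2_eq_square commutator_skew(2))

lemma zeta_rotate:
  assumes "x \<in> sp2" "y \<in> sp2"
  shows "zeta (c *\<^sub>R x + s *\<^sub>R y) (c *\<^sub>R y - s *\<^sub>R x) = (c\<^sup>2 + s\<^sup>2) *\<^sub>R zeta x y"
proof -
  have D: "im_adjoint D (el r u0 u1 u2) = imq u0" for r u0 u1 u2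
    by (simp add: el_def im_adjoint_D)
  obtain r u0 u1 u2 where "a_term x y = el r u0 u1 u2"
    by (rule el_exhaust[OF assms(1)], rule el_exhaust[OF assms(2)])
      (auto simp: a_term_def S_el commutator_el el_linear)
  then show ?thesis
    by (simp add: zeta_def a_term_rotate el_linear D)
qed

lemma S_symmetric:
  assumes "U \<in> sp2" "V \<in> sp2"
  shows "sp2_inner (S U) V = sp2_inner (S V) U"
  by (rule el_exhaust[OF assms(1)], rule el_exhaust[OF assms(2)])
    (simp add: S_el sp2_inner_el inner_diff_left inner_commute algebra_simps)

text \<open>
  The part that is not visibly alternating is \<open>B(S h, h) / 4 - B(S f\<^sub>x, f\<^sub>y)\<close>. Since \<open>h\<close> is the
  polarization of the quadratic map \<open>f\<close> and \<open>S\<close> is symmetric, it has the shape of a Gauss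
  equation, and such an expression depends on \<open>x\<close> and \<open>y\<close> only through \<open>x \<and> y\<close>.
\<close>

lemma delta3_rotate:
  assumes x: "x \<in> sp2" and y: "y \<in> sp2" and cs: "c\<^sup>2 + s\<^sup>2 = 1"
  shows "delta3 (c *\<^sub>R x + s *\<^sub>R y) (c *\<^sub>R y - s *\<^sub>R x) = delta3 x y"
proof -
  let ?x = "c *\<^sub>R x + s *\<^sub>R y" and ?y = "c *\<^sub>R y - s *\<^sub>R x"
  have sp: "f_term x \<in> sp2" "f_term y \<in> sp2" "h_term x y \<in> sp2"
    by (rule el_exhaust[OF x], rule el_exhaust[OF y],
        simp add: f_term_def h_term_def S_el commutator_el el_linear)+
  have h: "h_term x y = commutator (S x) y + commutator (S y) x"
    unfolding h_term_def using commutator_skew(1)[of x "S y"] by simp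
  have fx: "f_term ?x = c\<^sup>2 *\<^sub>R f_term x + s\<^sup>2 *\<^sub>R f_term y + (c * s) *\<^sub>R h_term x y"
    unfolding h f_term_def S_linear commutator_linear by (simp add: algebra_simps power2_eq_square)
  have fy: "f_term ?y = s\<^sup>2 *\<^sub>R f_term x + c\<^sup>2 *\<^sub>R f_term y - (c * s) *\<^sub>R h_term x y"
    unfolding h f_term_def S_linear commutator_linear by (simp add: algebra_simps power2_eq_square)
  have hxy: "h_term ?x ?y = (c * s) *\<^sub>R (f_term y - f_term x) + (c * s) *\<^sub>R (f_term y - f_term x)
      + (c\<^sup>2 - s\<^sup>2) *\<^sub>R h_term x y"
  proof -
    have "h_term ?x ?y = commutator (S ?x) ?y + commutator (S ?y) ?x"
      unfolding h_term_def using commutator_skew(1)[of ?x "S ?y"] by simp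
    then show ?thesis
      unfolding h f_term_def S_linear commutator_linear
      by (simp add: algebra_simps power2_eq_square)
  qed
  have "1/4 * sp2_inner (S (h_term ?x ?y)) (h_term ?x ?y) - sp2_inner (S (f_term ?x)) (f_term ?y) =
      1/4 * (c\<^sup>2 + s\<^sup>2)\<^sup>2 * sp2_inner (S (h_term x y)) (h_term x y)
      - (c\<^sup>2 + s\<^sup>2)\<^sup>2 * sp2_inner (S (f_term x)) (f_term y)"
    unfolding fx fy hxy S_linear sp2_inner_linear
    using S_symmetric[OF sp(2) sp(1)] S_symmetric[OF sp(3) sp(1)] S_symmetric[OF sp(3) sp(2)]
    by (simp add: algebra_simps power2_eq_square)
  then show ?thesis
    unfolding delta3_def a_term_rotate b_term_rotate cs by simp
qed

section \<open>A basis of square roots of minus one\<close>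

text \<open>
  The trace-free Hermitian matrices: a copy of \<open>\<real>\<^sup>5\<close> on which squaring gives scalars, as for
  Clifford vectors.
\<close>

definition herm :: "real \<Rightarrow> quat \<Rightarrow> qmat" where
  "herm t w = mat22 (of_real t) w (qcnj w) (- of_real t)"

lemma herm_nth [simp]: "herm t w $ 1 $ 1 = of_real t" "herm t w $ 1 $ 2 = w"
  "herm t w $ 2 $ 1 = qcnj w" "herm t w $ 2 $ 2 = - of_real t"
  by (simp_all add: herm_def)

lemma herm_exhaust:
  assumes "conj_transpose A = A" "qRe (trace A) = 0" obtains t w where "A = herm t w"
proof
  have entries: "A $ i $ j = qcnj (A $ j $ i)" for i j
    using arg_cong[OF assms(1), of "\<lambda>B. B $ i $ j"] by (simp add: conj_transpose_def)
  have "qRe (A $ 2 $ 2) = - qRe (A $ 1 $ 1)"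
    using assms(2) by (simp add: trace_def sum_2)
  then show "A = herm (qRe (A $ 1 $ 1)) (A $ 1 $ 2)"
    using entries[of 1 1] entries[of 2 2] entries[of 2 1] by (simp add: qmat_eq_iff quat_eq_iff)
qed

lemma herm_commute:
  assumes "herm t w ** herm t' w' = herm t' w' ** herm t w"
  shows "t *\<^sub>R w' = t' *\<^sub>R w" "w * qcnj w' = of_real (qRe (w * qcnj w'))"
proof -
  have eq: "(herm t w ** herm t' w') $ i $ j = (herm t' w' ** herm t w) $ i $ j" for i j
    by (simp add: assms)
  show "t *\<^sub>R w' = t' *\<^sub>R w"
    using eq[of 1 2] by (simp add: qmat_mult_nth quat_eq_iff)
  show "w * qcnj w' = of_real (qRe (w * qcnj w'))"
    using eq[of 1 1] by (simp add: qmat_mult_nth quat_eq_iff) argo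
qed

text \<open>
  As for Clifford vectors, commuting means being parallel. The coefficients are normalized to
  the unit circle because they will serve as cosine and sine of a doubled angle.
\<close>

lemma herm_dependent:
  assumes "herm t w ** herm t' w' = herm t' w' ** herm t w"
  obtains \<phi> where "cos \<phi> *\<^sub>R herm t w + sin \<phi> *\<^sub>R herm t' w' = 0"
proof -
  have herm0: "\<alpha> *\<^sub>R herm t w + \<beta> *\<^sub>R herm t' w' = 0"
    if "\<alpha> * t + \<beta> * t' = 0" "\<alpha> *\<^sub>R w + \<beta> *\<^sub>R w' = 0" for \<alpha> \<beta>
    using that by (auto simp: qmat_eq_iff quat_eq_iff)
  obtain \<alpha> \<beta> where lin: "\<alpha> \<noteq> 0 \<or> \<beta> \<noteq> 0" "\<alpha> * t + \<beta> * t' = 0" "\<alpha> *\<^sub>R w + \<beta> *\<^sub>R w' = 0"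
  proof (cases "w' = 0")
    case True
    then have "t' = 0 \<or> w = 0" using herm_commute(1)[OF assms] by simp
    then show thesis
      using that[of 0 1] that[of t' "- t"] True by (cases "t' = 0") simp_all
  next
    case False
    define \<kappa> where "\<kappa> = qRe (w * qcnj w')"
    have "qsq w' *\<^sub>R w = w * (qcnj w' * w')" by (simp add: qcnj_mult_self of_real_def)
    also have "\<dots> = of_real \<kappa> * w'"
      using herm_commute(2)[OF assms] by (simp add: \<kappa>_def flip: mult.assoc)
    finally have 1: "qsq w' *\<^sub>R w = \<kappa> *\<^sub>R w'" by (simp add: scaleR_conv_of_real)
    have "(t *\<^sub>R w') * qcnj w' = (t' *\<^sub>R w) * qcnj w'" by (simp only: herm_commute(1)[OF assms])
    then have "qRe (t *\<^sub>R (w' * qcnj w')) = qRe (t' *\<^sub>R (w * qcnj w'))" by simp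
    then have 2: "qsq w' * t = \<kappa> * t'"
      unfolding qcnj_mult_self \<kappa>_def by (simp add: mult.commute)
    show thesis using that[of "qsq w'" "- \<kappa>"] 1 2 False by (simp add: qsq_0_iff)
  qed
  define n where "n = sqrt (\<alpha>\<^sup>2 + \<beta>\<^sup>2)"
  have n: "n > 0" using lin(1) sum_power2_gt_zero_iff[of \<alpha> \<beta>] unfolding n_def by (simp only: real_sqrt_gt_0_iff)
  have "(\<alpha> / n)\<^sup>2 + (\<beta> / n)\<^sup>2 = (\<alpha>\<^sup>2 + \<beta>\<^sup>2) / n\<^sup>2" by (simp add: power_divide add_divide_distrib)
  also have "\<alpha>\<^sup>2 + \<beta>\<^sup>2 = n\<^sup>2" by (simp add: n_def)
  also have "n\<^sup>2 / n\<^sup>2 = 1" using n by simp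
  finally obtain \<phi> where "\<alpha> / n = cos \<phi>" "\<beta> / n = sin \<phi>" using sincos_total_2pi_le by blast
  moreover have "(\<alpha> / n) * t + (\<beta> / n) * t' = (\<alpha> * t + \<beta> * t') / n" by (simp add: add_divide_distrib)
  moreover have "(\<alpha> / n) *\<^sub>R w + (\<beta> / n) *\<^sub>R w' = (1 / n) *\<^sub>R (\<alpha> *\<^sub>R w + \<beta> *\<^sub>R w')"
    by (simp add: scaleR_right_distrib)
  ultimately show thesis using that[of \<phi>] herm0[of "\<alpha> / n" "\<beta> / n"] lin by simp
qed

text \<open>
  Put \<open>N = x\<^sup>2 + 1\<close> and \<open>M = x y\<close>. Orthonormality makes \<open>N\<close>, \<open>M\<close> and \<open>y\<^sup>2 + 1\<close> trace-free
  Hermitian, and they commute. From \<open>x\<^sup>2 y\<^sup>2 = (x y)\<^sup>2\<close> the sum \<open>N + (y\<^sup>2 + 1)\<close> is a scalar,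
  hence zero. So the rotated elements have squares \<open>- 1 \<plusminus> ((c\<^sup>2 - s\<^sup>2) N + 2 c s M)\<close>, and since
  \<open>N\<close> and \<open>M\<close> are parallel some angle removes the bracket.
\<close>

lemma rotate_to_square_roots:
  assumes x: "x \<in> sp2" and y: "y \<in> sp2" and comm: "x ** y = y ** x"
    and xx: "sp2_inner x x = 1" and yy: "sp2_inner y y = 1" and xy: "sp2_inner x y = 0"
  obtains c s where "c\<^sup>2 + s\<^sup>2 = 1"
    "(c *\<^sub>R x + s *\<^sub>R y) ** (c *\<^sub>R x + s *\<^sub>R y) = - mat 1"
    "(c *\<^sub>R y - s *\<^sub>R x) ** (c *\<^sub>R y - s *\<^sub>R x) = - mat 1"
proof -
  note ct = conj_transpose_simps conj_transpose_sp2[OF x] conj_transpose_sp2[OF y] qmat_bilinear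
  have tr: "qRe (trace (A + mat 1)) = qRe (trace A) + 2" for A :: qmat
    by (simp add: trace_def sum_2 mat_def)
  obtain t w where N: "x ** x + mat 1 = herm t w"
    by (rule herm_exhaust[of "x ** x + mat 1"])
      (use xx in \<open>auto simp: ct sp2_inner_def tr\<close>)
  obtain t1 w1 where N1: "y ** y + mat 1 = herm t1 w1"
    by (rule herm_exhaust[of "y ** y + mat 1"])
      (use yy in \<open>auto simp: ct sp2_inner_def tr\<close>)
  obtain t2 w2 where M: "x ** y = herm t2 w2"
    by (rule herm_exhaust[of "x ** y"]) (use xy comm in \<open>auto simp: ct sp2_inner_def\<close>)
  have assoc: "x ** x ** (x ** y) = x ** y ** (x ** x)" "x ** x ** (y ** y) = y ** y ** (x ** x)"
    "x ** x ** (y ** y) = x ** y ** (x ** y)"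
    by (metis comm matrix_mul_assoc)+
  have xx': "x ** x = herm t w - mat 1" and yy': "y ** y = herm t1 w1 - mat 1"
    using N N1 by (simp_all add: eq_diff_eq)
  have NM: "herm t w ** herm t2 w2 = herm t2 w2 ** herm t w"
    using assoc(1) by (simp add: xx' M qmat_bilinear)
  have NN1: "herm t w ** herm t1 w1 = herm t1 w1 ** herm t w"
    using assoc(2) by (simp add: xx' yy' qmat_bilinear)
  have sq: "herm t w ** herm t1 w1 - herm t w - herm t1 w1 + mat 1 = herm t2 w2 ** herm t2 w2"
    using assoc(3) by (simp add: xx' yy' M qmat_bilinear algebra_simps)
  have sq': "(herm t w ** herm t1 w1 - herm t w - herm t1 w1 + mat 1) $ i $ j =
      (herm t2 w2 ** herm t2 w2) $ i $ j" for i j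
    by (simp add: sq)
  have "w1 = - w"
  proof -
    have "t *\<^sub>R w1 - t1 *\<^sub>R w - w - w1 = 0"
      using sq'[of 1 2] by (simp add: qmat_mult_nth mat_def of_real_def)
    then show ?thesis using herm_commute(1)[OF NN1] by (simp add: algebra_simps eq_neg_iff_add_eq_0)
  qed
  moreover have "t1 = - t"
    using arg_cong[OF sq'[of 1 1], of qRe] arg_cong[OF sq'[of 2 2], of qRe]
    by (simp add: qmat_mult_nth mat_def algebra_simps)
  ultimately have yy'': "y ** y = - herm t w - mat 1"
    unfolding yy' by (simp add: qmat_eq_iff quat_eq_iff)
  obtain \<phi> where \<phi>: "cos \<phi> *\<^sub>R herm t w + sin \<phi> *\<^sub>R herm t2 w2 = 0"
    by (rule herm_dependent[OF NM])
  define c s where "c = cos (\<phi> / 2)" and "s = sin (\<phi> / 2)"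
  have cs: "c\<^sup>2 + s\<^sup>2 = 1" by (simp add: c_def s_def)
  have "cos \<phi> = c\<^sup>2 - s\<^sup>2" "sin \<phi> = 2 * (c * s)"
    using cos_double[of "\<phi> / 2"] sin_double[of "\<phi> / 2"] by (simp_all add: c_def s_def)
  with \<phi> have \<phi>': "(c\<^sup>2 - s\<^sup>2) *\<^sub>R herm t w + (2 * (c * s)) *\<^sub>R herm t2 w2 = 0" by simp
  have yx: "y ** x = herm t2 w2" using comm M by simp
  have "(c *\<^sub>R x + s *\<^sub>R y) ** (c *\<^sub>R x + s *\<^sub>R y) =
      (c\<^sup>2 - s\<^sup>2) *\<^sub>R herm t w + (2 * (c * s)) *\<^sub>R herm t2 w2 - (c\<^sup>2 + s\<^sup>2) *\<^sub>R mat 1"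
    by (simp add: qmat_bilinear xx' yy'' M yx)
      (simp add: qmat_eq_iff quat_eq_iff mat_def algebra_simps power2_eq_square)
  moreover have "(c *\<^sub>R y - s *\<^sub>R x) ** (c *\<^sub>R y - s *\<^sub>R x) =
      - ((c\<^sup>2 - s\<^sup>2) *\<^sub>R herm t w + (2 * (c * s)) *\<^sub>R herm t2 w2) - (c\<^sup>2 + s\<^sup>2) *\<^sub>R mat 1"
    by (simp add: qmat_bilinear xx' yy'' M yx)
      (simp add: qmat_eq_iff quat_eq_iff mat_def algebra_simps power2_eq_square)
  ultimately show thesis using that[OF cs] by (simp only: \<phi>' cs) simp
qed

section \<open>The moment map of the first column\<close>

definition col1 :: "qmat \<Rightarrow> quat^2" where
  "col1 g = (\<chi> i. g $ i $ 1)"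

text \<open>
  Pairing \<open>J\<^sub>g\<^sup>* x = 0\<close> with \<open>\<xi>\<close> and moving \<open>g\<^sup>*\<close> around the trace turns \<open>E\<^sub>g\<close> into the
  quaternion \<open>p\<^sup>* x p\<close>, where \<open>p\<close> is the first column of \<open>g\<close>. Of \<open>g\<close> only the unit vector \<open>p\<close>
  matters.
\<close>

lemma horizontal_moment:
  assumes g: "g \<in> Sp2" and x: "x \<in> sp2" and J: "im_adjoint (J g) x = 0"
  shows "hip (col1 g) (x *v col1 g) = x $ 1 $ 1 + x $ 2 $ 2"
proof -
  let ?p = "col1 g"
  have "sp2_inner x (J g \<xi>) = 0" if "\<xi> \<in> ImH" for \<xi>
    using theI'[OF ex1_im_adjoint[OF linear_J[of g], of x]] J that
    unfolding im_adjoint_def by (auto simp: im_dot_def)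
  moreover have "sp2_inner x (J g \<xi>) = - (1/2) * qRe ((x $ 1 $ 1 + x $ 2 $ 2 - hip ?p (x *v ?p)) * \<xi>)" for \<xi>
  proof -
    have "qRe (trace (x ** E g \<xi>)) = qRe (hip ?p (x *v ?p) * \<xi>)"
    proof -
      have c: "qRe (a * (b * \<xi> * qcnj d)) = qRe (qcnj d * (a * b) * \<xi>)" for a b d
        using qRe_commute[of "a * b * \<xi>" "qcnj d"] by (simp only: mult.assoc)
      show ?thesis
        by (simp add: E_def trace_def sum_2 qmat_mult_nth conj_transpose_def hip_def matvec_nth col1_def
            distrib_left distrib_right c del: quat_sel(25-28)) 
    qed
    moreover have "qRe (trace (x ** D \<xi>)) = qRe ((x $ 1 $ 1 + x $ 2 $ 2) * \<xi>)"
      by (simp add: D_def trace_def sum_2 qmat_mult_nth algebra_simps)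
    ultimately show ?thesis
      unfolding J_def sp2_inner_linear unfolding sp2_inner_def Rings.left_diff_distrib quat_sel(17)
      by (simp only: Rings.right_diff_distrib)
  qed
  ultimately have 0: "qRe ((x $ 1 $ 1 + x $ 2 $ 2 - hip ?p (x *v ?p)) * \<xi>) = 0" if "\<xi> \<in> ImH" for \<xi>
    using that by simp
  have "qcnj (hip ?p (x *v ?p)) = hip (x *v ?p) ?p"
    by (simp add: hip_def)
  also have "\<dots> = - hip ?p (x *v ?p)"
    using hip_adjoint[of ?p x ?p] conj_transpose_sp2[OF x] by (simp add: matvec_linear hip_linear)
  finally have "qRe (hip ?p (x *v ?p)) = 0"
    using qcnj_sel(1)[of "hip ?p (x *v ?p)"] by (simp del: qcnj_sel quat_sel(25-28))
  then show ?thesis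
    using 0[of "Quat 0 1 0 0"] 0[of "Quat 0 0 1 0"] 0[of "Quat 0 0 0 1"] x
    by (simp add: quat_eq_iff ImH_def sp2_iff)
qed

lemma col1_unit:
  assumes "g \<in> Sp2" shows "hip (col1 g) (col1 g) = 1"
proof -
  have "(conj_transpose g ** g) $ 1 $ 1 = 1" using assms by (simp add: Sp2_def mat_def)
  then show ?thesis by (simp add: hip_def col1_def qmat_mult_nth conj_transpose_def)
qed

text \<open>
  \<open>p\<^sup>* (w 1) p\<close> is a convex combination of two rotated copies of \<open>w\<close>, so it cannot be twice as
  long as \<open>w\<close> unless \<open>w = 0\<close>. This excludes elements \<open>(0; w, 0, 0)\<close> from the plane of \<open>x\<close> and
  \<open>y\<close>.
\<close>

lemma scalar_moment_contracts:
  assumes p: "hip p p = 1" and w: "hip p (el 0 w 0 0 *v p) = 2 *\<^sub>R imq w"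
  shows "w = 0"
proof -
  have ineq: "- qRe (imq w * (qcnj q * imq w * q)) \<le> qsq q * (w \<bullet> w)" for q
  proof -
    let ?v = "vector [qI q, qJ q, qK q] :: real^3"
    have "qsq q * (w \<bullet> w) + qRe (imq w * (qcnj q * imq w * q)) = 2 * ((w \<times> ?v) \<bullet> (w \<times> ?v))"
      by (simp add: qsq_def inner_vec_def sum_3 cross_components power2_eq_square algebra_simps)
    then show ?thesis using inner_ge_zero[of "w \<times> ?v"] by linarith
  qed
  have "qsq (p $ 1) + qsq (p $ 2) = 1"
    using arg_cong[OF p, of qRe] by (simp add: hip_self del: of_real_add)
  moreover have "- qRe (imq w * hip p (el 0 w 0 0 *v p)) \<le> (qsq (p $ 1) + qsq (p $ 2)) * (w \<bullet> w)"
    using ineq[of "p $ 1"] ineq[of "p $ 2"]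
    by (simp add: hip_def matvec_nth distrib_left distrib_right mult.assoc del: quat_sel(25-28) imq_linear(2-5))
  moreover have "- qRe (imq w * hip p (el 0 w 0 0 *v p)) = 2 * (w \<bullet> w)"
    unfolding w by (simp add: inner_vec_def sum_3 algebra_simps)
  ultimately have "w \<bullet> w \<le> 0" by simp
  then show ?thesis using inner_gt_zero_iff[of w] by linarith
qed

text \<open>
  \<open>(A + B)\<^sup>2 = - 4 P\<close> with \<open>P = (1 - A B) / 2\<close>, the projection onto a quaternionic line that
  contains the image of \<open>A + B\<close>. Hence \<open>p\<^sup>* (A + B) p\<close> pairs the vectors \<open>P p\<close> and \<open>(A + B) p\<close>
  of this line, whose lengths are both determined by \<open>p\<^sup>* P p\<close>.
\<close>

lemma qsq_moment_sum:
  assumes A: "A \<in> sp2" and B: "B \<in> sp2" and AA: "A ** A = - mat 1" and BB: "B ** B = - mat 1"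
    and comm: "A ** B = B ** A" and orth: "sp2_inner A B = 0" and p: "hip p p = 1"
  shows "qsq (hip p ((A + B) *v p)) = (1 - qRe (hip p ((A ** B) *v p)))\<^sup>2"
proof -
  note ct = conj_transpose_simps conj_transpose_sp2[OF A] conj_transpose_sp2[OF B] qmat_bilinear
  define P where "P = (1/2) *\<^sub>R (mat 1 - A ** B)"
  have mul: "A ** B ** (A ** B) = mat 1" "A ** B ** A = - B" "A ** B ** B = - A"
  proof -
    show 1: "A ** B ** B = - A" using BB by (simp add: matrix_mul_assoc[symmetric] ct)
    show 2: "A ** B ** A = - B" unfolding comm using AA by (simp add: matrix_mul_assoc[symmetric] ct)
    show "A ** B ** (A ** B) = mat 1" using 2 BB by (simp add: matrix_mul_assoc ct)
  qed
  have herm: "conj_transpose P = P" by (simp add: P_def ct comm)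
  have idem: "P ** P = P"
    by (simp add: P_def ct mul scaleR_right_diff_distrib) (simp add: qmat_eq_iff quat_eq_iff field_simps)
  have tr: "qRe (P $ 1 $ 1) + qRe (P $ 2 $ 2) = 1"
    using orth by (simp add: P_def sp2_inner_def trace_def sum_2 mat_def field_simps)
  have PX: "P ** (A + B) = A + B"
    by (simp add: P_def ct mul scaleR_right_distrib) (simp add: qmat_eq_iff quat_eq_iff field_simps)
  have XX: "(A + B) ** (A + B) = (- 4) *\<^sub>R P"
    using AA BB comm by (simp add: P_def ct) (simp add: qmat_eq_iff quat_eq_iff mat_def field_simps)
  have X: "conj_transpose (A + B) = - (A + B)" by (simp add: ct)
  define \<omega> where "\<omega> = qRe (hip p ((A ** B) *v p))"
  have Pp: "qRe (hip p (P *v p)) = (1 - \<omega>) / 2"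
    by (simp add: P_def matvec_linear hip_linear p \<omega>_def)
  have "hip p ((A + B) *v p) = hip (P *v p) ((A + B) *v p)"
    using hip_adjoint[of p P "(A + B) *v p"] by (simp add: herm matrix_vector_mul_assoc PX)
  moreover have "qsq (hip (P *v p) ((A + B) *v p)) =
      qRe (hip (P *v p) (P *v p)) * qRe (hip ((A + B) *v p) ((A + B) *v p))"
    by (rule qsq_hip_line[OF herm tr idem]) (simp_all add: matrix_vector_mul_assoc idem PX)
  moreover have "hip (P *v p) (P *v p) = hip p (P *v p)"
    using hip_adjoint[of p P "P *v p"] by (simp add: herm matrix_vector_mul_assoc idem)
  moreover have "hip ((A + B) *v p) ((A + B) *v p) = 4 *\<^sub>R hip p (P *v p)"
    using hip_adjoint[of p "A + B" "(A + B) *v p"]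
    by (simp only: X matvec_linear(3) hip_linear matrix_vector_mul_assoc XX matvec_linear(4)) simp
  ultimately show ?thesis by (simp add: Pp power2_eq_square field_simps flip: \<omega>_def)
qed

text \<open>
  The preceding formula for \<open>B\<close> and for \<open>- B\<close> gives \<open>4 |u \<plusminus> v|\<^sup>2 = (1 \<minusplus> \<omega>)\<^sup>2\<close>. When \<open>u\<close> and \<open>v\<close>
  are orthogonal both left sides agree, so \<open>\<omega> = 0\<close>.
\<close>

lemma moment_norms:
  assumes A: "A \<in> sp2" and B: "B \<in> sp2" and AA: "A ** A = - mat 1" and BB: "B ** B = - mat 1"
    and comm: "A ** B = B ** A" and orth: "sp2_inner A B = 0" and p: "hip p p = 1"
    and u: "hip p (A *v p) = 2 *\<^sub>R imq u" and v: "hip p (B *v p) = 2 *\<^sub>R imq v" and uv: "u \<bullet> v = 0"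
  shows "u \<bullet> u + v \<bullet> v = 1/4"
proof -
  define \<omega> where "\<omega> = qRe (hip p ((A ** B) *v p))"
  have B': "- B \<in> sp2" using B by (simp add: sp2_iff)
  have 1: "qsq (2 *\<^sub>R imq (u + v)) = (1 - \<omega>)\<^sup>2"
    using qsq_moment_sum[OF A B AA BB comm orth p]
    by (simp add: matvec_linear hip_linear u v \<omega>_def scaleR_right_distrib)
  have 2: "qsq (2 *\<^sub>R imq (u - v)) = (1 + \<omega>)\<^sup>2"
    using qsq_moment_sum[OF A B' AA _ _ _ p] comm orth BB sp2_inner_linear(6)[of A "-1" B]
    by (simp add: matvec_linear hip_linear u v \<omega>_def qmat_bilinear scaleR_right_diff_distrib)
  have "4 * (u \<bullet> u + v \<bullet> v) = (1 - \<omega>)\<^sup>2" "4 * (u \<bullet> u + v \<bullet> v) = (1 + \<omega>)\<^sup>2"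
    using 1 2 uv by (simp_all add: inner_add_left inner_add_right inner_diff_left inner_diff_right inner_commute)
  moreover from this have "\<omega> = 0" by (simp add: power2_eq_square algebra_simps)
  ultimately show ?thesis by simp
qed

section \<open>Solving the vector equations\<close>

text \<open>
  Here \<open>y = (0; v0, v1, v2)\<close> has no real coordinate. Every equation is paired with one of the
  \<open>v\<^sub>i\<close>; the triple products cancel and leave \<open>|v2|\<^sup>2 = - v0 \<bullet> v2\<close> and
  \<open>|v1|\<^sup>2 = |v2|\<^sup>2 + v0 \<bullet> v2\<close>, so \<open>v1 = 0\<close>, and then the equation for \<open>\<zeta>\<close> gives \<open>v2 = 0\<close>.
\<close>

lemma zeta_zero_forces_scalar:
  fixes u0 u1 u2 v0 v1 v2 :: "real^3"
  assumes c0: "u0 \<times> v0 + u1 \<times> v1 + u2 \<times> v2 = 0"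
    and c1: "u0 \<times> v1 + u1 \<times> v0 = - r *\<^sub>R v2"
    and c2: "u0 \<times> v2 + u2 \<times> v0 = r *\<^sub>R v1"
    and z: "u1 \<times> v2 + u2 \<times> v1 = - r *\<^sub>R v2"
    and r: "r \<noteq> 0"
  shows "v1 = 0" "v2 = 0"
proof -
  have c0': "(u0 \<times> v0 + u1 \<times> v1 + u2 \<times> v2) \<bullet> v1 = 0" by (simp add: c0)
  have c1': "(u0 \<times> v1 + u1 \<times> v0) \<bullet> w = - r * (v2 \<bullet> w)" for w by (simp add: c1)
  have c2': "(u0 \<times> v2 + u2 \<times> v0) \<bullet> w = r * (v1 \<bullet> w)" for w by (simp add: c2)
  have z': "(u1 \<times> v2 + u2 \<times> v1) \<bullet> w = - r * (v2 \<bullet> w)" for w by (simp add: z)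
  have "r * (v2 \<bullet> v0 + v2 \<bullet> v2) = 0"
    using c0' c1'[of v0] z'[of v2] by (simp add: cross3_simps)
  moreover have "r * (v1 \<bullet> v1 - v2 \<bullet> v2 - v2 \<bullet> v0) = 0"
    using c1'[of v2] c2'[of v1] z'[of v0] by (simp add: cross3_simps)
  ultimately have "v1 \<bullet> v1 = 0" using r by (smt (verit) mult_eq_0_iff)
  then show v1: "v1 = 0" by (simp only: inner_eq_zero_iff)
  have "r * (v2 \<bullet> v2) = 0"
    using z'[of v2] by (simp add: v1 dot_cross_self)
  then show "v2 = 0" using r by simp
qed

lemma common_direction:
  fixes u v :: "real^3"
  assumes "u \<times> v = 0" "\<not> (u = 0 \<and> v = 0)"
  obtains e p q where "e \<bullet> e = 1" "u = p *\<^sub>R e" "v = q *\<^sub>R e"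
proof -
  have unit: "inverse (norm w) *\<^sub>R w \<bullet> inverse (norm w) *\<^sub>R w = 1"
    "w = norm w *\<^sub>R inverse (norm w) *\<^sub>R w" if "w \<noteq> 0" for w :: "real^3"
    using that by (simp_all add: dot_square_norm power2_eq_square)
  show thesis
  proof (cases "u = 0")
    case True
    then show thesis using that[of "inverse (norm v) *\<^sub>R v" 0 "norm v"] unit assms by auto
  next
    case False
    obtain c where "v = c *\<^sub>R u"
      using assms(1) False unfolding cross_eq_0 collinear_lemma by auto
    with that[of "inverse (norm u) *\<^sub>R u" "norm u" "c * norm u"] unit[OF False]
    show thesis by (metis scaleR_scaleR)
  qed
qed

lemma orthogonal_frame_component:
  fixes e f w :: "real^3"
  assumes "e \<bullet> e = 1" "f \<bullet> f = 1" "e \<bullet> f = 0" "w \<bullet> e = 0" "w \<bullet> (e \<times> f) = 0"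
  shows "w = (w \<bullet> f) *\<^sub>R f"
proof -
  define z where "z = w - (w \<bullet> f) *\<^sub>R f"
  have z: "z \<bullet> e = 0" "z \<bullet> f = 0" "z \<bullet> (e \<times> f) = 0"
    using assms by (simp_all add: z_def inner_diff_left inner_diff_right inner_commute dot_cross_self)
  have "(e \<times> f) \<bullet> (e \<times> f) = (e \<bullet> e) * (f \<bullet> f) - (e \<bullet> f)\<^sup>2"
    by (simp add: cross3_simps power2_eq_square)
  then have "e \<times> f \<noteq> 0" using assms by auto
  moreover have "z \<times> (e \<times> f) = (z \<bullet> f) *\<^sub>R e - (z \<bullet> e) *\<^sub>R f"
    by (simp add: Lagrange)
  ultimately have "z = 0" using norm_and_cross_eq_0[of z "e \<times> f"] z by auto
  then show ?thesis by (simp add: z_def)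
qed

text \<open>
  If \<open>e \<bullet> f \<noteq> 0\<close> then \<open>(p', q')\<close> is a multiple \<open>\<mu> (p, q)\<close>, and independence makes \<open>\<mu>\<close> and
  \<open>e \<times> f\<close> nonzero. Pairing the remaining equations with \<open>e \<times> f\<close> gives \<open>v0 \<bullet> e = - \<mu> (u0 \<bullet> f)\<close>
  from one side and \<open>(u0 \<bullet> f)(v0 \<bullet> e) = \<mu> |(p, q)|\<^sup>2 |e \<times> f|\<^sup>2\<close> from the other, and these have
  opposite signs.
\<close>

lemma plane_directions_orthogonal:
  fixes e f u0 v0 :: "real^3"
  assumes e: "e \<bullet> e = 1" and f: "f \<bullet> f = 1"
    and indep: "\<And>c s. c *\<^sub>R p *\<^sub>R e + s *\<^sub>R p' *\<^sub>R f = 0 \<Longrightarrow> c *\<^sub>R q *\<^sub>R e + s *\<^sub>R q' *\<^sub>R f = 0 \<Longrightarrow> c = 0 \<and> s = 0"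
    and ue: "u0 \<bullet> e = 0" and vf: "v0 \<bullet> f = 0"
    and c0: "u0 \<times> v0 + (p * p' + q * q') *\<^sub>R (e \<times> f) = 0"
    and c1: "p' *\<^sub>R (u0 \<times> f) = p *\<^sub>R (v0 \<times> e)"
    and c2: "q' *\<^sub>R (u0 \<times> f) = q *\<^sub>R (v0 \<times> e)"
    and cr: "(q * p' - p * q') * (e \<bullet> f) = 0"
    and z: "(p * q' + q * p') *\<^sub>R (e \<times> f) = 0"
  shows "e \<bullet> f = 0"
proof (rule ccontr)
  assume ef: "e \<bullet> f \<noteq> 0"
  have n: "p \<noteq> 0 \<or> q \<noteq> 0" using indep[of 1 0] by auto
  have n': "p' \<noteq> 0 \<or> q' \<noteq> 0" using indep[of 0 1] by auto
  define \<mu> where "\<mu> = (p * p' + q * q') / (p\<^sup>2 + q\<^sup>2)"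
  have d: "p\<^sup>2 + q\<^sup>2 > 0" using n by (simp add: sum_power2_gt_zero_iff)
  have eq: "q * p' = p * q'" using cr ef by simp
  have p': "p' = \<mu> * p" and q': "q' = \<mu> * q"
  proof -
    have "p' * (p\<^sup>2 + q\<^sup>2) = (p * p' + q * q') * p" "q' * (p\<^sup>2 + q\<^sup>2) = (p * p' + q * q') * q"
      using eq by algebra+
    moreover have "t = (p * p' + q * q') / (p\<^sup>2 + q\<^sup>2) * w"
      if "t * (p\<^sup>2 + q\<^sup>2) = (p * p' + q * q') * w" for t w
      using d that by (metis less_irrefl nonzero_mult_div_cancel_right times_divide_eq_left)
    ultimately show "p' = \<mu> * p" "q' = \<mu> * q"
      unfolding \<mu>_def by blast+
  qed
  have \<mu>: "\<mu> \<noteq> 0" using n' p' q' by auto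
  have "e \<times> f \<noteq> 0"
  proof
    assume "e \<times> f = 0"
    then have "f = (e \<bullet> f) *\<^sub>R e"
      using Lagrange[of e e f] e by simp
    then obtain c where fc: "f = c *\<^sub>R e" by blast
    show False
      using indep[of "- \<mu> * c" 1] by (simp add: fc p' q')
  qed
  then have ef2: "(e \<times> f) \<bullet> (e \<times> f) > 0" by simp
  have "p *\<^sub>R (\<mu> *\<^sub>R (u0 \<times> f) - v0 \<times> e) = 0" "q *\<^sub>R (\<mu> *\<^sub>R (u0 \<times> f) - v0 \<times> e) = 0"
    using c1 c2 by (simp_all add: p' q' scaleR_right_diff_distrib mult.commute)
  then have "\<mu> *\<^sub>R (u0 \<times> f) - v0 \<times> e = 0" using n by (simp only: scaleR_eq_0_iff) blast
  then have "(\<mu> *\<^sub>R (u0 \<times> f) - v0 \<times> e) \<bullet> (e \<times> f) = 0" by simp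
  moreover have "(\<mu> *\<^sub>R (u0 \<times> f) - v0 \<times> e) \<bullet> (e \<times> f)
    = \<mu> * ((u0 \<bullet> e) * (f \<bullet> f) - (u0 \<bullet> f) * (e \<bullet> f)) - ((v0 \<bullet> e) * (e \<bullet> f) - (v0 \<bullet> f) * (e \<bullet> e))"
    by (simp add: cross3_simps)
  ultimately have "(e \<bullet> f) * (\<mu> * (u0 \<bullet> f) + v0 \<bullet> e) = 0"
    using ue vf e f by (simp add: algebra_simps)
  then have v: "v0 \<bullet> e = - \<mu> * (u0 \<bullet> f)" using ef by simp
  have "(u0 \<times> v0 + (p * p' + q * q') *\<^sub>R (e \<times> f)) \<bullet> (e \<times> f) = 0" by (simp add: c0)
  moreover have "(u0 \<times> v0) \<bullet> (e \<times> f) = (u0 \<bullet> e) * (v0 \<bullet> f) - (u0 \<bullet> f) * (v0 \<bullet> e)"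
    by (simp add: cross3_simps)
  ultimately have "\<mu> * ((u0 \<bullet> f)\<^sup>2 + (p\<^sup>2 + q\<^sup>2) * ((e \<times> f) \<bullet> (e \<times> f))) = 0"
    using ue v by (simp add: p' q' inner_add_left power2_eq_square algebra_simps)
  then have "(u0 \<bullet> f)\<^sup>2 + (p\<^sup>2 + q\<^sup>2) * ((e \<times> f) \<bullet> (e \<times> f)) = 0" using \<mu> by simp
  moreover have "(p\<^sup>2 + q\<^sup>2) * ((e \<times> f) \<bullet> (e \<times> f)) > 0" using d ef2 by simp
  ultimately show False using zero_le_power2[of "u0 \<bullet> f"] by linarith
qed

section \<open>The normal form and its lower bound\<close>

text \<open>
  All vectors lie on the axes of the frame \<open>e\<close>, \<open>f\<close>, \<open>e \<times> f\<close>, so each bracket is explicit. The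
  relations \<open>m\<close> and \<open>k\<close> remove the mixed terms; in particular
  \<open>(q\<^sup>2 - p\<^sup>2)(q'\<^sup>2 - p'\<^sup>2) = (p p' + q q')\<^sup>2 - (p q' + q p')\<^sup>2 = (a b)\<^sup>2\<close>.
\<close>

lemma delta3_normal_form:
  fixes e f :: "real^3"
  assumes e: "e \<bullet> e = 1" and f: "f \<bullet> f = 1" and ef: "e \<bullet> f = 0"
    and m: "a * b + p * p' + q * q' = 0" and k: "p * q' + q * p' = 0"
  shows "delta3 (el 0 (a *\<^sub>R f) (p *\<^sub>R e) (q *\<^sub>R e)) (el 0 (- b *\<^sub>R e) (p' *\<^sub>R f) (q' *\<^sub>R f)) =
    4 * (b\<^sup>2 * p * q + a\<^sup>2 * p' * q') + 12 * (b\<^sup>2 * q\<^sup>2 + a\<^sup>2 * q'\<^sup>2) + 12 * a * b * q * q' - 12 * (a * b)\<^sup>2"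
proof -
  have g: "f \<bullet> e = 0" "f \<times> e = - (e \<times> f)" "(e \<times> f) \<bullet> (e \<times> f) = 1"
    "e \<bullet> (e \<times> f) = 0" "f \<bullet> (e \<times> f) = 0" "(e \<times> f) \<bullet> e = 0" "(e \<times> f) \<bullet> f = 0"
    using ef cross_skew[of f e] norm_cross_dot[of e f] e f
    by (simp_all add: inner_commute dot_cross_self power2_norm_eq_inner power_mult_distrib)
  \<comment> \<open>The simplifier collects equal vectors into componentwise products with numerals.\<close>
  have numeral_scaleR: "numeral n * w = (numeral n :: real) *\<^sub>R w" for n and w :: "real^3"
    by (simp add: vec_eq_iff)
  show ?thesis
    using m k
    by (simp add: delta3_def a_term_def b_term_def h_term_def f_term_def S_el commutator_el
        sp2_inner_el el_linear e f ef g numeral_scaleR cross_mult_left cross_mult_right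
        Cross3.left_diff_distrib Cross3.right_diff_distrib
        inner_add_left inner_add_right inner_diff_left inner_diff_right) algebra
qed

text \<open>
  Up to sign the constraints leave one parameter. With \<open>\<rho> = p p' - q q'\<close>, \<open>\<kappa> = q p'\<close>, \<open>\<mu> = a b\<close>
  and \<open>\<sigma> = b\<^sup>2 - a\<^sup>2\<close> they become \<open>\<rho>\<^sup>2 = 3/4 + \<mu>\<^sup>2\<close>, \<open>\<kappa>\<^sup>2 = 3/16\<close> and \<open>\<sigma>\<^sup>2 + 4 \<mu>\<^sup>2 = 1/16\<close>, and
  the products \<open>q\<^sup>2 \<rho>\<close>, \<open>p q \<rho>\<close> and their primed versions are polynomials in \<open>a, b, \<rho>, \<kappa>, \<mu>\<close>.
  So the left side equals \<open>3/2 - 30 \<mu>\<^sup>2 + (4 \<kappa> \<sigma> - 3 \<mu> - 18 \<mu>\<^sup>3) / \<rho>\<close>. Cauchy-Schwarz bounds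
  \<open>4 \<kappa> \<sigma> - 3 \<mu>\<close>, and the crude bounds \<open>|\<mu>| \<le> 1/8\<close> and \<open>|\<rho>| \<ge> \<surd>3 / 2\<close> suffice for \<open>8/25\<close>, which
  exceeds \<open>(\<surd>5 - 1) / 4\<close>.
\<close>

lemma normal_form_lower_bound:
  fixes a b p q p' q' :: real
  assumes x: "a\<^sup>2 + p\<^sup>2 + q\<^sup>2 = 1" and y: "b\<^sup>2 + p'\<^sup>2 + q'\<^sup>2 = 1"
    and m: "a * b + p * p' + q * q' = 0" and k: "p * q' + q * p' = 0"
    and J: "a\<^sup>2 + b\<^sup>2 = 1/4"
  shows "4 * (b\<^sup>2 * p * q + a\<^sup>2 * p' * q') + 12 * (b\<^sup>2 * q\<^sup>2 + a\<^sup>2 * q'\<^sup>2)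
      + 12 * a * b * q * q' - 12 * (a * b)\<^sup>2 \<ge> (sqrt 5 - 1) / 4" (is "?d \<ge> _")
proof -
  define \<rho> \<kappa> \<mu> \<sigma> where "\<rho> = p * p' - q * q'" and "\<kappa> = q * p'" and "\<mu> = a * b" and "\<sigma> = b\<^sup>2 - a\<^sup>2"
  note defs = this
  have P: "p\<^sup>2 + q\<^sup>2 = 1 - a\<^sup>2" and Q: "p'\<^sup>2 + q'\<^sup>2 = 1 - b\<^sup>2" using x y by simp_all
  have PQ: "(p\<^sup>2 + q\<^sup>2) * (p'\<^sup>2 + q'\<^sup>2) = 3/4 + \<mu>\<^sup>2"
    unfolding P Q using J by (simp add: defs algebra_simps power2_eq_square)
  have "\<rho>\<^sup>2 = (p\<^sup>2 + q\<^sup>2) * (p'\<^sup>2 + q'\<^sup>2) - (p * q' + q * p')\<^sup>2"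
    unfolding defs by (simp add: power2_eq_square algebra_simps)
  then have \<rho>: "\<rho>\<^sup>2 = 3/4 + \<mu>\<^sup>2" using PQ k by simp
  have "(p\<^sup>2 + q\<^sup>2) * (p'\<^sup>2 + q'\<^sup>2) = (p * p' + q * q')\<^sup>2 + (q * p' - p * q')\<^sup>2"
    by algebra
  also have "p * p' + q * q' = - \<mu>" using m by (simp add: defs)
  also have "q * p' - p * q' = 2 * \<kappa>" using k unfolding defs by linarith
  finally have \<kappa>: "\<kappa>\<^sup>2 = 3/16" using PQ by (simp add: power2_eq_square)
  have \<sigma>: "\<sigma>\<^sup>2 + 4 * \<mu>\<^sup>2 = 1/16"
  proof -
    have "\<sigma>\<^sup>2 + 4 * \<mu>\<^sup>2 = (a\<^sup>2 + b\<^sup>2)\<^sup>2" unfolding defs by algebra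
    then show ?thesis unfolding J by (simp add: power2_eq_square)
  qed
  have qq: "2 * (q * q') = - \<mu> - \<rho>" using m by (simp add: defs)
  have "2 * (q\<^sup>2 * \<rho>) = (- 2 * (q * q')) * (p\<^sup>2 + q\<^sup>2) + 2 * p * q * (p * q' + q * p')"
    by (simp add: defs power2_eq_square algebra_simps)
  then have q2: "2 * (q\<^sup>2 * \<rho>) = (\<mu> + \<rho>) * (1 - a\<^sup>2)"
    using qq k P by simp
  have "2 * (q'\<^sup>2 * \<rho>) = (- 2 * (q * q')) * (p'\<^sup>2 + q'\<^sup>2) + 2 * p' * q' * (p * q' + q * p')"
    by (simp add: defs power2_eq_square algebra_simps)
  then have q2': "2 * (q'\<^sup>2 * \<rho>) = (\<mu> + \<rho>) * (1 - b\<^sup>2)"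
    using qq k Q by simp
  have "p * q * \<rho> = \<kappa> * (p\<^sup>2 + q\<^sup>2) - q\<^sup>2 * (p * q' + q * p')"
    by (simp add: defs power2_eq_square algebra_simps)
  then have pq: "p * q * \<rho> = \<kappa> * (1 - a\<^sup>2)" using k P by simp
  have "p' * q' * \<rho> = - \<kappa> * (p'\<^sup>2 + q'\<^sup>2) + p'\<^sup>2 * (p * q' + q * p')"
    by (simp add: defs power2_eq_square algebra_simps)
  then have pq': "p' * q' * \<rho> = - \<kappa> * (1 - b\<^sup>2)" using k Q by simp
  have "?d * \<rho> = 4 * (b\<^sup>2 * (p * q * \<rho>) + a\<^sup>2 * (p' * q' * \<rho>))
      + 6 * (b\<^sup>2 * (2 * (q\<^sup>2 * \<rho>)) + a\<^sup>2 * (2 * (q'\<^sup>2 * \<rho>)))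
      + 6 * \<mu> * (2 * (q * q')) * \<rho> - 12 * \<mu>\<^sup>2 * \<rho>"
    by (simp add: defs(3) power2_eq_square algebra_simps)
  also have "\<dots> = 4 * \<kappa> * \<sigma> + 6 * (\<mu> + \<rho>) * (a\<^sup>2 + b\<^sup>2 - 2 * \<mu>\<^sup>2) - 6 * \<mu> * \<rho> * (\<mu> + \<rho>) - 12 * \<mu>\<^sup>2 * \<rho>"
    unfolding qq q2 q2' pq pq' defs(3,4) by (simp add: power2_eq_square algebra_simps)
  also have "\<dots> = (3/2 - 30 * \<mu>\<^sup>2) * \<rho> + (4 * \<kappa> * \<sigma> + 3/2 * \<mu> - 12 * \<mu> ^ 3 - 6 * \<mu> * \<rho>\<^sup>2)"
    unfolding J by (simp add: algebra_simps power2_eq_square power3_eq_cube)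
  also have "\<dots> = (3/2 - 30 * \<mu>\<^sup>2) * \<rho> + (4 * \<kappa> * \<sigma> - 3 * \<mu> - 18 * \<mu> ^ 3)"
    unfolding \<rho> by (simp add: algebra_simps power2_eq_square power3_eq_cube)
  finally have d: "?d * \<rho> = (3/2 - 30 * \<mu>\<^sup>2) * \<rho> + (4 * \<kappa> * \<sigma> - 3 * \<mu> - 18 * \<mu> ^ 3)" .
  have \<mu>2: "\<mu>\<^sup>2 \<le> 1/64" using \<sigma> zero_le_power2[of \<sigma>] by linarith
  then have "\<bar>\<mu>\<bar> \<le> \<bar>1/8\<bar>" unfolding abs_le_square_iff by (simp add: power2_eq_square)
  then have \<mu>1: "\<bar>\<mu>\<bar> \<le> 1/8" by simp
  have \<mu>3: "\<bar>\<mu> ^ 3\<bar> \<le> 1/512"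
    using power_mono[OF \<mu>1, of 3] by (simp add: power_abs power_divide)
  \<comment> \<open>Cauchy-Schwarz for the vectors \<open>(4 \<kappa>, - 3/2)\<close> and \<open>(\<sigma>, 2 \<mu>)\<close>, as a Lagrange identity.\<close>
  have "(4 * \<kappa> * \<sigma> - 3 * \<mu>)\<^sup>2 + (4 * \<kappa> * (2 * \<mu>) + 3/2 * \<sigma>)\<^sup>2
      = (16 * \<kappa>\<^sup>2 + 9/4) * (\<sigma>\<^sup>2 + 4 * \<mu>\<^sup>2)"
    by (simp add: power2_eq_square algebra_simps)
  also have "\<dots> = 21/64" by (simp add: \<kappa> \<sigma>)
  finally have "(4 * \<kappa> * \<sigma> - 3 * \<mu>)\<^sup>2 \<le> 21/64"
    using zero_le_power2[of "4 * \<kappa> * (2 * \<mu>) + 3/2 * \<sigma>"] by linarith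
  also have "\<dots> \<le> (573/1000)\<^sup>2" by (simp add: power2_eq_square)
  finally have "\<bar>4 * \<kappa> * \<sigma> - 3 * \<mu>\<bar> \<le> \<bar>(573/1000)\<bar>" unfolding abs_le_square_iff .
  then have "\<bar>4 * \<kappa> * \<sigma> - 3 * \<mu>\<bar> \<le> (573/1000)" by simp
  then have N: "\<bar>4 * \<kappa> * \<sigma> - 3 * \<mu> - 18 * \<mu> ^ 3\<bar> \<le> 3041/5000" using \<mu>3 by linarith
  have "(433/500)\<^sup>2 \<le> \<rho>\<^sup>2" using \<rho> zero_le_power2[of \<mu>] by (simp add: power2_eq_square)
  then have "\<bar>(433/500)\<bar> \<le> \<bar>\<rho>\<bar>" unfolding abs_le_square_iff .
  then have \<rho>1: "(433/500) \<le> \<bar>\<rho>\<bar>" by simp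
  have "?d \<ge> 8/25"
  proof -
    have "(?d - (3/2 - 30 * \<mu>\<^sup>2)) * \<rho> = 4 * \<kappa> * \<sigma> - 3 * \<mu> - 18 * \<mu> ^ 3" using d by (simp add: algebra_simps)
    then have "\<bar>?d - (3/2 - 30 * \<mu>\<^sup>2)\<bar> * \<bar>\<rho>\<bar> \<le> 3041/5000" using N by (simp flip: abs_mult)
    moreover have "\<bar>?d - (3/2 - 30 * \<mu>\<^sup>2)\<bar> * (433/500) \<le> \<bar>?d - (3/2 - 30 * \<mu>\<^sup>2)\<bar> * \<bar>\<rho>\<bar>"
      using \<rho>1 by (intro mult_left_mono) auto
    ultimately have "\<bar>?d - (3/2 - 30 * \<mu>\<^sup>2)\<bar> * (433/500) \<le> 3041/5000" by linarith
    moreover have "8/25 \<le> d" if "\<bar>d - (3/2 - 30 * m)\<bar> * (433/500) \<le> 3041/5000" "m \<le> 1/64" for d m :: real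
    proof -
      have "\<bar>d - (3/2 - 30 * m)\<bar> \<le> 3041/4330" using that(1) by simp
      then show ?thesis using that(2) by linarith
    qed
    ultimately show ?thesis using \<mu>2 by blast
  qed
  moreover have "sqrt 5 \<le> 57/25" by (rule real_le_lsqrt) (simp_all add: power2_eq_square)
  ultimately show ?thesis by simp
qed

text \<open>
  The case \<open>x\<^sup>2 = y\<^sup>2 = - 1\<close>, to which the general one is rotated: here the vectors \<open>u\<^sub>i\<close> and
  \<open>v\<^sub>i\<close> can be put on the axes of one orthonormal frame.
\<close>

lemma delta3_ge_of_square_roots:
  assumes eX: "X = el r u0 u1 u2" and eY: "Y = el s v0 v1 v2"
    and XX: "X ** X = - mat 1" and YY: "Y ** Y = - mat 1"
    and comm: "commutator X Y = 0" and zeta: "zeta X Y = 0"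
    and nX: "sp2_inner X X = 1" and nY: "sp2_inner Y Y = 1" and nXY: "sp2_inner X Y = 0"
    and p: "hip p p = 1"
    and pX: "hip p (X *v p) = 2 *\<^sub>R imq u0" and pY: "hip p (Y *v p) = 2 *\<^sub>R imq v0"
  shows "delta3 X Y \<ge> (sqrt 5 - 1) / 4"
proof -
  let ?X = "el r u0 u1 u2" and ?Y = "el s v0 v1 v2"
  note XX = XX[unfolded eX] and YY = YY[unfolded eY] and comm = comm[unfolded eX eY]
    and zeta = zeta[unfolded eX eY] and nX = nX[unfolded eX] and nY = nY[unfolded eY]
    and nXY = nXY[unfolded eX eY] and pX = pX[unfolded eX] and pY = pY[unfolded eY]
  \<comment> \<open>A vanishing combination would put some \<open>(0; w, 0, 0)\<close> into the plane of \<open>X\<close> and \<open>Y\<close>.\<close>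
  have indep: "c = 0 \<and> d = 0"
    if "c * r + d * s = 0" "c *\<^sub>R u1 + d *\<^sub>R v1 = 0" "c *\<^sub>R u2 + d *\<^sub>R v2 = 0" for c d
  proof -
    have eq: "c *\<^sub>R ?X + d *\<^sub>R ?Y = el 0 (c *\<^sub>R u0 + d *\<^sub>R v0) 0 0"
      using that by (simp add: el_linear)
    have "hip p ((c *\<^sub>R ?X + d *\<^sub>R ?Y) *v p) = 2 *\<^sub>R imq (c *\<^sub>R u0 + d *\<^sub>R v0)"
      by (simp add: matvec_linear hip_linear pX pY scaleR_right_distrib mult.commute)
    then have "c *\<^sub>R u0 + d *\<^sub>R v0 = 0"
      unfolding eq by (rule scalar_moment_contracts[OF p])
    then have "c *\<^sub>R ?X + d *\<^sub>R ?Y = 0" using eq by (simp add: el_0)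
    then have "sp2_inner (c *\<^sub>R ?X + d *\<^sub>R ?Y) (c *\<^sub>R ?X + d *\<^sub>R ?Y) = sp2_inner 0 0" by simp
    moreover have "sp2_inner 0 0 = 0" using sp2_inner_linear(3)[of 0 0 0] by simp
    moreover have "sp2_inner ?Y ?X = 0" using nXY sp2_inner_commute by metis
    ultimately have "c\<^sup>2 + d\<^sup>2 = 0"
      unfolding sp2_inner_linear nX nY nXY by (simp add: power2_eq_square)
    then show ?thesis by simp
  qed
  \<comment> \<open>Otherwise change the basis so that one element has real coordinate \<open>0\<close> and the other does not;
    the first is then of the excluded form \<open>(0; w, 0, 0)\<close>.\<close>
  have rs: "r = 0 \<and> s = 0"
  proof (rule ccontr)
    assume "\<not> (r = 0 \<and> s = 0)"
    moreover define t where "t = r\<^sup>2 + s\<^sup>2"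
    ultimately have t: "t \<noteq> 0" by simp
    define x0 x1 x2 where "x0 = r *\<^sub>R u0 + s *\<^sub>R v0" and "x1 = r *\<^sub>R u1 + s *\<^sub>R v1" and "x2 = r *\<^sub>R u2 + s *\<^sub>R v2"
    define y0 y1 y2 where "y0 = r *\<^sub>R v0 - s *\<^sub>R u0" and "y1 = r *\<^sub>R v1 - s *\<^sub>R u1" and "y2 = r *\<^sub>R v2 - s *\<^sub>R u2"
    have X': "r *\<^sub>R ?X + s *\<^sub>R ?Y = el t x0 x1 x2"
      by (simp add: el_linear x0_def x1_def x2_def t_def power2_eq_square)
    have Y': "r *\<^sub>R ?Y - s *\<^sub>R ?X = el 0 y0 y1 y2"
      by (simp add: el_linear y0_def y1_def y2_def mult.commute)
    have "commutator (el t x0 x1 x2) (el 0 y0 y1 y2) = 0"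
      unfolding X'[symmetric] Y'[symmetric] commutator_rotate comm by simp
    then have c: "x0 \<times> y0 + x1 \<times> y1 + x2 \<times> y2 = 0"
      "x0 \<times> y1 + x1 \<times> y0 + t *\<^sub>R y2 = 0" "x0 \<times> y2 + x2 \<times> y0 - t *\<^sub>R y1 = 0"
      unfolding commutator_el el_0[symmetric] el_eq_iff by simp_all
    have "zeta (el t x0 x1 x2) (el 0 y0 y1 y2) = 0"
      unfolding X'[symmetric] Y'[symmetric] zeta_rotate[OF el_in_sp2 el_in_sp2] zeta by simp
    then have z: "x0 \<times> y1 + x1 \<times> y0 - x1 \<times> y2 - x2 \<times> y1 = 0"
      unfolding zeta_el imq_linear(1)[symmetric] imq_inject by simp
    have c1: "x0 \<times> y1 + x1 \<times> y0 = - t *\<^sub>R y2" using c(2) by (simp add: eq_neg_iff_add_eq_0)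
    have c2: "x0 \<times> y2 + x2 \<times> y0 = t *\<^sub>R y1" using c(3) by simp
    have "x1 \<times> y2 + x2 \<times> y1 = x0 \<times> y1 + x1 \<times> y0" using z by (simp add: algebra_simps)
    then have z': "x1 \<times> y2 + x2 \<times> y1 = - t *\<^sub>R y2" using c1 by simp
    have "y1 = 0" "y2 = 0" using zeta_zero_forces_scalar[OF c(1) c1 c2 z' t] by simp_all
    then have "- s = 0 \<and> r = 0" using indep[of "- s" r] by (simp add: y1_def y2_def)
    then show False using t t_def by simp
  qed
  then have r: "r = 0" and s: "s = 0" by simp_all
  note cs = comm[unfolded commutator_el el_0[symmetric] el_eq_iff r s, simplified]
  note sqX = el_square_scalar[OF XX, unfolded r, simplified] and sqY = el_square_scalar[OF YY, unfolded s, simplified]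
  \<comment> \<open>With \<open>r = s = 0\<close>, scalar squares make \<open>u1, u2\<close> parallel, and likewise \<open>v1, v2\<close>.\<close>
  obtain e p1 p2 where e: "e \<bullet> e = 1" and u1: "u1 = p1 *\<^sub>R e" and u2: "u2 = p2 *\<^sub>R e"
    using common_direction[OF sqX(3)] indep[of 1 0] r s by auto
  obtain f q1 q2 where f: "f \<bullet> f = 1" and v1: "v1 = q1 *\<^sub>R f" and v2: "v2 = q2 *\<^sub>R f"
    using common_direction[OF sqY(3)] indep[of 0 1] r s by auto
  have indep': "c = 0 \<and> d = 0" if "c *\<^sub>R p1 *\<^sub>R e + d *\<^sub>R q1 *\<^sub>R f = 0" "c *\<^sub>R p2 *\<^sub>R e + d *\<^sub>R q2 *\<^sub>R f = 0" for c d
    using indep[of c d] that by (simp add: r s u1 u2 v1 v2)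
  have n: "p1 \<noteq> 0 \<or> p2 \<noteq> 0" and n': "q1 \<noteq> 0 \<or> q2 \<noteq> 0" using indep'[of 1 0] indep'[of 0 1] by auto
  have ue: "u0 \<bullet> e = 0" using sqX(1,2) n by (auto simp: u1 u2)
  have vf: "v0 \<bullet> f = 0" using sqY(1,2) n' by (auto simp: v1 v2)
  have c0: "u0 \<times> v0 + (p1 * q1 + p2 * q2) *\<^sub>R (e \<times> f) = 0"
    using cs by (simp add: u1 u2 v1 v2 cross_mult_left cross_mult_right scaleR_left_distrib add.assoc mult.commute)
  have c1: "q1 *\<^sub>R (u0 \<times> f) = p1 *\<^sub>R (v0 \<times> e)" and c2: "q2 *\<^sub>R (u0 \<times> f) = p2 *\<^sub>R (v0 \<times> e)"
    using cs by (simp_all add: cross_skew[of e v0] u1 u2 v1 v2 cross_mult_left cross_mult_right)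
  have cr: "(p2 * q1 - p1 * q2) * (e \<bullet> f) = 0"
    using cs by (auto simp: u1 u2 v1 v2 mult.commute)
  have "u0 \<times> v1 + u1 \<times> v0 - u1 \<times> v2 - u2 \<times> v1 = 0" "u0 \<times> v1 + u1 \<times> v0 = 0"
    using zeta cs unfolding zeta_el imq_linear(1)[symmetric] imq_inject by simp_all
  then have "u1 \<times> v2 + u2 \<times> v1 = 0"
    by (metis add.commute diff_0 neg_eq_iff_add_eq_0 right_minus_eq)
  then have z: "(p1 * q2 + p2 * q1) *\<^sub>R (e \<times> f) = 0"
    by (simp add: u1 u2 v1 v2 cross_mult_left cross_mult_right scaleR_left_distrib mult.commute)
  have ef: "e \<bullet> f = 0" by (rule plane_directions_orthogonal[OF e f indep' ue vf c0 c1 c2 cr z])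
  have "(e \<times> f) \<bullet> (e \<times> f) = 1"
    using norm_cross_dot[of e f] by (simp add: power2_norm_eq_inner power_mult_distrib e f ef)
  then have ef0: "e \<times> f \<noteq> 0" by auto
  have k: "p1 * q2 + p2 * q1 = 0" using z ef0 by simp
  have u_ef: "u0 \<bullet> (e \<times> f) = 0"
  proof -
    have "(q1 *\<^sub>R (u0 \<times> f)) \<bullet> e = 0" "(q2 *\<^sub>R (u0 \<times> f)) \<bullet> e = 0" unfolding c1 c2 by (simp_all add: dot_cross_self)
    then have "(u0 \<times> f) \<bullet> e = 0" using n' by auto
    then show ?thesis using cross_triple[of f e u0] cross_triple[of u0 f e] cross_skew[of f e] by (simp add: inner_commute)
  qed
  have v_ef: "v0 \<bullet> (f \<times> e) = 0"
  proof -
    have "(p1 *\<^sub>R (v0 \<times> e)) \<bullet> f = 0" "(p2 *\<^sub>R (v0 \<times> e)) \<bullet> f = 0"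
      unfolding c1[symmetric] c2[symmetric] by (simp_all add: dot_cross_self)
    then have "(v0 \<times> e) \<bullet> f = 0" using n by auto
    then show ?thesis using cross_triple[of v0 e f] cross_skew[of f e] by (simp add: inner_commute)
  qed
  \<comment> \<open>So \<open>u0\<close> is a multiple of \<open>f\<close> and \<open>v0\<close> of \<open>e\<close>, which is the normal form.\<close>
  define a b where "a = u0 \<bullet> f" and "b = - (v0 \<bullet> e)"
  have u0: "u0 = a *\<^sub>R f" unfolding a_def by (rule orthogonal_frame_component[OF e f ef ue u_ef])
  have v0: "v0 = - b *\<^sub>R e" unfolding b_def
    using orthogonal_frame_component[OF f e _ vf v_ef] ef by (simp add: inner_commute)
  have m: "a * b + p1 * q1 + p2 * q2 = 0"
  proof -
    have "(a * b + p1 * q1 + p2 * q2) *\<^sub>R (e \<times> f) = 0"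
      using c0 cross_skew[of f e] by (simp add: u0 v0 cross_mult_left cross_mult_right scaleR_left_distrib add.assoc mult.commute)
    then show ?thesis using ef0 by simp
  qed
  have x: "a\<^sup>2 + p1\<^sup>2 + p2\<^sup>2 = 1" and y: "b\<^sup>2 + q1\<^sup>2 + q2\<^sup>2 = 1"
    using nX nY by (simp_all add: r s sp2_inner_el u0 v0 u1 u2 v1 v2 e f power2_eq_square)
  have "u0 \<bullet> u0 + v0 \<bullet> v0 = 1/4"
    using moment_norms[OF el_in_sp2 el_in_sp2 XX YY _ nXY p pX pY] comm ef
    by (simp add: commutator_def u0 v0 inner_commute)
  then have "a\<^sup>2 + b\<^sup>2 = 1/4" by (simp add: u0 v0 e f power2_eq_square)
  from normal_form_lower_bound[OF x y m k this] show ?thesis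
    unfolding eX eY r s u0 v0 u1 u2 v1 v2 using delta3_normal_form[OF e f ef m k] by simp
qed

theorem theorem5p2:
  fixes g x y :: "quat^2^2"
  assumes "(g, x, y) \<in> Z_set"
  shows "delta3 x y \<ge> (sqrt 5 - 1) / 4 \<and> (sqrt 5 - 1) / 4 > (1/4 :: real)"
proof
  have g: "g \<in> Sp2" and x: "x \<in> sp2" and y: "y \<in> sp2"
    and Jx: "im_adjoint (J g) x = 0" and Jy: "im_adjoint (J g) y = 0"
    and n: "sp2_inner x x = 1" "sp2_inner y y = 1" "sp2_inner x y = 0"
    and comm: "commutator x y = 0" and zeta: "zeta x y = 0"
    using assms by (auto simp: Z_set_def I_set_def sp2_norm_def)
  obtain c s where cs: "c\<^sup>2 + s\<^sup>2 = 1"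
    and sq: "(c *\<^sub>R x + s *\<^sub>R y) ** (c *\<^sub>R x + s *\<^sub>R y) = - mat 1"
      "(c *\<^sub>R y - s *\<^sub>R x) ** (c *\<^sub>R y - s *\<^sub>R x) = - mat 1"
    using rotate_to_square_roots[OF x y _ n] comm by (auto simp: commutator_def)
  define X Y where "X = c *\<^sub>R x + s *\<^sub>R y" and "Y = c *\<^sub>R y - s *\<^sub>R x"
  have X: "X \<in> sp2" and Y: "Y \<in> sp2"
    by (rule el_exhaust[OF x], rule el_exhaust[OF y], simp add: X_def Y_def el_linear)+
  obtain r u0 u1 u2 where eX: "X = el r u0 u1 u2" by (rule el_exhaust[OF X])
  obtain t v0 v1 v2 where eY: "Y = el t v0 v1 v2" by (rule el_exhaust[OF Y])
  have "sp2_inner y x = 0" using n(3) sp2_inner_commute by metis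
  then have nX: "sp2_inner X X = 1" and nY: "sp2_inner Y Y = 1" and nXY: "sp2_inner X Y = 0"
    unfolding X_def Y_def sp2_inner_linear using n cs by (simp_all add: power2_eq_square add.commute)
  define p where "p = col1 g"
  have "hip p (x *v p) = x $ 1 $ 1 + x $ 2 $ 2" "hip p (y *v p) = y $ 1 $ 1 + y $ 2 $ 2"
    unfolding p_def using horizontal_moment[OF g] x y Jx Jy by simp_all
  then have "hip p (X *v p) = X $ 1 $ 1 + X $ 2 $ 2" "hip p (Y *v p) = Y $ 1 $ 1 + Y $ 2 $ 2"
    by (simp_all add: X_def Y_def matvec_linear hip_linear algebra_simps)
  then have pX: "hip p (X *v p) = 2 *\<^sub>R imq u0" and pY: "hip p (Y *v p) = 2 *\<^sub>R imq v0"
    by (simp_all add: eX eY scaleR_2)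
  have cXY: "commutator X Y = 0" and zXY: "zeta X Y = 0"
    unfolding X_def Y_def commutator_rotate zeta_rotate[OF x y] comm zeta by simp_all
  have p: "hip p p = 1" unfolding p_def by (rule col1_unit[OF g])
  have "delta3 X Y \<ge> (sqrt 5 - 1) / 4"
    using delta3_ge_of_square_roots[OF eX eY _ _ cXY zXY nX nY nXY p pX pY] sq
    unfolding X_def Y_def by blast
  then show "delta3 x y \<ge> (sqrt 5 - 1) / 4"
    unfolding X_def Y_def delta3_rotate[OF x y cs] .
  show "(sqrt 5 - 1) / 4 > (1/4 :: real)"
    using real_less_rsqrt[of 2 5] by simp
qed

end
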